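(* Let $\mathcal{E}$ be the whole-line CMV matrix corresponding to a sequence $\{\alpha_n\}_{n\in\mathbb{Z}}$ with $|\alpha_n|\le1$, satisfying $\alpha_n\ne0$ for at least two different $n\in\mathbb{Z}$. For $n\in\mathbb{Z}$ let $\mu_n$ be the spectral measure of $\mathcal{E}$ and $\delta_n$, and let $A\subseteq\partial\mathbb{D}$ be a Borel set. Then $\mathcal{E}$ is reflectionless on $A$ if and only if the measure $\mu_n$ is reflectionless on $A$ for all $n\in\mathbb{Z}$.
   Context: Let $\mathbb{D}$ be the open unit disc. Given $\{\alpha_n\}_{n\in\mathbb{Z}}$ with $|\alpha_n|\le1$, the whole-line CMV matrix is the unitary operator $\mathcal{E}=\mathcal{L}\mathcal{M}$ on $\ell^2(\mathbb{Z})$, where $\mathcal{L}$ is the direct sum over $k\in\mathbb{Z}$ of the blocks $\Theta_{2k}$ acting on coordinates $2k,2k+1$, $\mathcal{M}$ is the direct sum of the blocks $\Theta_{2k-1}$ acting on coordinates $2k-1,2k$, and $\Theta_k=\begin{pmatrix}\bar\alpha_k&\rho_k\\ \rho_k&-\alpha_k\end{pmatrix}$, $\rho_k=(1-|\alpha_k|^2)^{1/2}$. $\{\delta_n\}$ is the standard basis of $\ell^2(\mathbb{Z})$, and $\mu_n$ is the probability measure on $\partial\mathbb{D}$ with $\int_0^{2\pi} \frac{e^{i\theta}+z}{e^{i\theta}-z}\,d\mu_n(\theta)=\langle\delta_n,(\mathcal{E}+z)(\mathcal{E}-z)^{-1}\delta_n\rangle$, $z\in\mathbb{D}$. A Schur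 function is an analytic $f$ on $\mathbb{D}$ with $|f|\le1$; its radial boundary values exist a.e. on $\partial\mathbb{D}$. $f(z;\gamma_0,\gamma_1,\dots)$ denotes the Schur function $f=f_0$ with Schur parameters $\gamma_n$, i.e. $\gamma_n=f_n(0)$ and $zf_{n+1}(z)=\frac{f_n(z)-\gamma_n}{1-\bar\gamma_nf_n(z)}$; if some $|\gamma_n|=1$ the algorithm stops there ($f_n\equiv\gamma_n$) and $f$ is a finite Blaschke product. Put $f_+(z,n)=f(z;\alpha_n,\alpha_{n+1},\dots)$ and $f_-(z,n)=f(z;-\overline{\alpha_{n-1}},-\overline{\alpha_{n-2}},\dots)$. The matrix $\mathcal{E}$ is reflectionless on $A$ if for all $n\in\mathbb{Z}$, $zf_+(z,n)=\overline{f_-(z,n)}$ for Lebesgue a.e. $z\in A$. A probability measure $\nu$ on $\partial\mathbb{D}$ is reflectionless on $A$ if its Carath\'eodory function $F(z)=\int_0^{2\pi}\frac{e^{i\theta}+z}{e^{i\theta}-z}\,d\nu(\theta)$ has radial boundary values satisfying $\operatorname{Im}F(e^{i\theta})=0$ for Lebesgue a.e. $e^{i\theta}\in A$. *)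

theory Defs
  imports "HOL-Complex_Analysis.Complex_Analysis" "HOL-Probability.Probability"
begin

section \<open>The whole-line CMV matrix\<close>

definition ell2 :: "(int \<Rightarrow> complex) set" where
  "ell2 = {u. (\<lambda>k. (cmod (u k))\<^sup>2) summable_on UNIV}"

definition ell2_inner :: "(int \<Rightarrow> complex) \<Rightarrow> (int \<Rightarrow> complex) \<Rightarrow> complex" where
  "ell2_inner u v = (\<Sum>\<^sub>\<infinity>k. cnj (u k) * v k)"

definition delta :: "int \<Rightarrow> int \<Rightarrow> complex" where
  "delta n = (\<lambda>k. if k = n then 1 else 0)"

definition rho :: "complex \<Rightarrow> real" where
  "rho a = sqrt (1 - (cmod a)\<^sup>2)"

definition Theta :: "complex \<Rightarrow> complex^2^2" where
  "Theta a = vector [vector [cnj a, of_real (rho a)],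
                     vector [of_real (rho a), - a]]"

text \<open>The block \<open>\<Theta>\<^sub>j\<close> acts on the coordinates \<open>j\<close> and \<open>j + 1\<close>. All rows of the matrices below
  have finite support, so the operators are defined on arbitrary sequences; as operators on
  \<open>\<ell>\<^sup>2(\<int>)\<close> they are considered on \<^const>\<open>ell2\<close>.\<close>

definition cmv_block :: "(int \<Rightarrow> complex) \<Rightarrow> int \<Rightarrow> (int \<Rightarrow> complex) \<Rightarrow> complex^2" where
  "cmv_block \<alpha> j u = Theta (\<alpha> j) *v vector [u j, u (j + 1)]"

definition cmv_L :: "(int \<Rightarrow> complex) \<Rightarrow> (int \<Rightarrow> complex) \<Rightarrow> int \<Rightarrow> complex" where
  "cmv_L \<alpha> u k = (if even k then cmv_block \<alpha> k u $ 1 else cmv_block \<alpha> (k - 1) u $ 2)"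

definition cmv_M :: "(int \<Rightarrow> complex) \<Rightarrow> (int \<Rightarrow> complex) \<Rightarrow> int \<Rightarrow> complex" where
  "cmv_M \<alpha> u k = (if odd k then cmv_block \<alpha> k u $ 1 else cmv_block \<alpha> (k - 1) u $ 2)"

definition cmv :: "(int \<Rightarrow> complex) \<Rightarrow> (int \<Rightarrow> complex) \<Rightarrow> int \<Rightarrow> complex" where
  "cmv \<alpha> u = cmv_L \<alpha> (cmv_M \<alpha> u)"

text \<open>The inverse of \<open>\<E> - z\<close> is taken on \<open>\<ell>\<^sup>2(\<int>)\<close>. For \<open>\<bar>z\<bar> < 1\<close> it exists, since \<open>\<E>\<close> is unitary.\<close>

definition cmv_resolvent :: "(int \<Rightarrow> complex) \<Rightarrow> complex \<Rightarrow> (int \<Rightarrow> complex) \<Rightarrow> int \<Rightarrow> complex" where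
  "cmv_resolvent \<alpha> z = the_inv_into ell2 (\<lambda>u k. cmv \<alpha> u k - z * u k)"

section \<open>Probability measures on the unit circle and spectral measures\<close>

definition circle_prob :: "complex measure \<Rightarrow> bool" where
  "circle_prob \<nu> \<longleftrightarrow> prob_space \<nu> \<and> sets \<nu> = sets (restrict_space borel (sphere 0 1))"

definition caratheodory :: "complex measure \<Rightarrow> complex \<Rightarrow> complex" where
  "caratheodory \<nu> z = (\<integral>w. (w + z) / (w - z) \<partial>\<nu>)"

definition is_spectral_measure :: "(int \<Rightarrow> complex) \<Rightarrow> int \<Rightarrow> complex measure \<Rightarrow> bool" where
  "is_spectral_measure \<alpha> n \<nu> \<longleftrightarrow> circle_prob \<nu> \<and>
     (\<forall>z\<in>ball 0 1. caratheodory \<nu> z =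
        (let \<psi> = cmv_resolvent \<alpha> z (delta n)
         in ell2_inner (delta n) (\<lambda>k. cmv \<alpha> \<psi> k + z * \<psi> k)))"

section \<open>Schur functions\<close>

definition schur_function :: "(complex \<Rightarrow> complex) \<Rightarrow> bool" where
  "schur_function f \<longleftrightarrow> f holomorphic_on ball 0 1 \<and> (\<forall>z\<in>ball 0 1. cmod (f z) \<le> 1)"

text \<open>\<open>F n\<close> is the \<open>n\<close>-th Schur iterate \<open>f\<^sub>n\<close>. At the first parameter of modulus one the algorithm
  stops, and later values of \<open>\<gamma>\<close> and \<open>F\<close> are irrelevant.\<close>

definition has_schur_parameters :: "(complex \<Rightarrow> complex) \<Rightarrow> (nat \<Rightarrow> complex) \<Rightarrow> bool" where
  "has_schur_parameters f \<gamma> \<longleftrightarrow>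
     (\<exists>F. F 0 = f \<and>
       (\<forall>n. (\<forall>k<n. cmod (\<gamma> k) < 1) \<longrightarrow>
          schur_function (F n) \<and> F n 0 = \<gamma> n \<and>
          (if cmod (\<gamma> n) < 1
           then \<forall>z\<in>ball 0 1. z * F (Suc n) z = (F n z - \<gamma> n) / (1 - cnj (\<gamma> n) * F n z)
           else \<forall>z\<in>ball 0 1. F n z = \<gamma> n)))"

text \<open>If \<open>\<bar>\<gamma>\<^sub>n\<bar> \<le> 1\<close> for all \<open>n\<close>, a function with these Schur parameters exists and its values on the
  unit disc are unique; the values elsewhere are arbitrary and never used.\<close>

definition schur_fun :: "(nat \<Rightarrow> complex) \<Rightarrow> complex \<Rightarrow> complex" where
  "schur_fun \<gamma> = (SOME f. has_schur_parameters f \<gamma>)"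

definition f_plus :: "(int \<Rightarrow> complex) \<Rightarrow> int \<Rightarrow> complex \<Rightarrow> complex" where
  "f_plus \<alpha> n = schur_fun (\<lambda>k. \<alpha> (n + int k))"

definition f_minus :: "(int \<Rightarrow> complex) \<Rightarrow> int \<Rightarrow> complex \<Rightarrow> complex" where
  "f_minus \<alpha> n = schur_fun (\<lambda>k. - cnj (\<alpha> (n - 1 - int k)))"

section \<open>Reflectionless matrices and measures\<close>

definition has_radial_limit :: "(complex \<Rightarrow> complex) \<Rightarrow> complex \<Rightarrow> complex \<Rightarrow> bool" where
  "has_radial_limit f w l \<longleftrightarrow> ((\<lambda>r::real. f (of_real r * w)) \<longlongrightarrow> l) (at_left 1)"

definition ae_on_circle :: "complex set \<Rightarrow> (complex \<Rightarrow> bool) \<Rightarrow> bool" where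
  "ae_on_circle A P \<longleftrightarrow> (AE t in lebesgue_on {0..2*pi}. cis t \<in> A \<longrightarrow> P (cis t))"

text \<open>The boundary values are quantified explicitly. By Fatou's theorem (for Caratheodory functions,
  via a Cayley transform) they exist almost everywhere on the circle, so requiring their existence at
  almost every point of \<open>A\<close> is no additional restriction.\<close>

definition reflectionless_cmv :: "(int \<Rightarrow> complex) \<Rightarrow> complex set \<Rightarrow> bool" where
  "reflectionless_cmv \<alpha> A \<longleftrightarrow>
     (\<forall>n. ae_on_circle A (\<lambda>w. \<exists>a b. has_radial_limit (f_plus \<alpha> n) w a \<and>
                                    has_radial_limit (f_minus \<alpha> n) w b \<and> w * a = cnj b))"

definition reflectionless_measure :: "complex measure \<Rightarrow> complex set \<Rightarrow> bool" where
  "reflectionless_measure \<nu> A \<longleftrightarrow>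
     ae_on_circle A (\<lambda>w. \<exists>l. has_radial_limit (caratheodory \<nu>) w l \<and> Im l = 0)"

end

theory Submission
  imports Defs
begin

text \<open>Since \<open>E\<close> is unitary, \<open>(E - z)\<^sup>-\<^sup>1 \<delta>\<^sub>n\<close> is a Neumann series in \<open>\<ell>\<^sup>2\<close>, and along each half-line the
  ratios of its entries and of those of its image under \<open>M\<close> are forced by decay to be
  \<open>f\<^sub>+\<close> and \<open>f\<^sub>-\<close>. Hence \<open>F\<^sub>n = (1 + P\<^sub>n) / (1 - P\<^sub>n)\<close> with \<open>P\<^sub>n(z) = z f\<^sub>+(z,n) f\<^sub>-(z,n)\<close>, and \<open>F\<^sub>n\<close> is real
  at a boundary point iff \<open>P\<^sub>n\<close> is real, which gives one direction.

  Conversely, put \<open>u = f\<^sub>+(z,n)\<close> and \<open>v = z f\<^sub>-(z,n)\<close>. If \<open>0 < \<bar>\<alpha>\<^sub>n\<bar> < 1\<close>, reality of \<open>P\<^sub>n\<close> and \<open>P\<^sub>n\<^sub>+\<^sub>1\<close> makes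
  the product and the sum of \<open>cnj \<alpha>\<^sub>n u\<close> and \<open>\<alpha>\<^sub>n v\<close> real, so either \<open>u = cnj v\<close>, which is the
  reflectionless identity, or both numbers are real. If the second alternative held at two
  consecutive nonzero coefficients \<open>\<alpha>\<^sub>n\<close>, \<open>\<alpha>\<^sub>m\<close>, then \<open>z\<^sup>m\<^sup>-\<^sup>n \<alpha>\<^sub>m cnj \<alpha>\<^sub>n\<close> would be real, which holds for finitely
  many \<open>z\<close> only. The identity then propagates to all sites, as Schur steps with \<open>\<bar>\<alpha>\<bar> < 1\<close> preserve it;
  at a coefficient of modulus one it contradicts the boundary uniqueness theorem.\<close>

section \<open>Schur functions with given parameters\<close>

text \<open>The converse cannot be settled at a single site. If exactly one
  \<open>\<alpha> n\<close> is nonzero, then every \<open>P\<^sub>m\<close> vanishes identically and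
  all measures are reflectionless, yet the identity fails at n, where f_+ equals
  \<open>\<alpha> n\<close> and f_- is zero. This is why two nonzero sites have to be compared.
  Coefficients of modulus one shape the set-up. There rho = 0 decouples the half-lines, and transfer
  matrices, which divide by rho, do not exist. The recursions are therefore written with one
  quantity running outwards and one running inwards, so that rho occurs only as a factor, and the
  Schur algorithm is run backwards, where a unimodular parameter merely gives a constant map. Every
  exceptional null set comes from one fact: a bounded holomorphic function that is nonzero at 0 has
  radial limit 0 almost nowhere. It says nothing about existence of limits, so it combines with
  limits that are constructed algebraically from those of the \<open>P\<^sub>n\<close>.\<close>

definition schur_step :: "complex \<Rightarrow> complex \<Rightarrow> complex" where
  "schur_step g w = (g + w) / (1 + cnj g * w)"

lemma schur_step_denom_nz:
  assumes "cmod g \<le> 1" "cmod w < 1"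
  shows "1 + cnj g * w \<noteq> 0"
proof
  assume "1 + cnj g * w = 0"
  then have "cnj g * w = -1" by (simp add: add_eq_0_iff)
  then have "cmod g * cmod w = 1" by (metis complex_mod_cnj norm_mult norm_minus_cancel norm_one)
  moreover have "cmod g * cmod w \<le> 1 * cmod w" using assms by (intro mult_right_mono) auto
  ultimately show False using assms by simp
qed

text \<open>This encodes the stopping rule: a unimodular parameter swallows the rest of the
  recursion. Hence \<open>f\<^sub>n = schur_step (\<gamma> n) (z *
  f\<^sub>n\<^sub>+\<^sub>1)\<close> can be used at every n without a case distinction.\<close>

lemma schur_step_boundary:
  assumes "cmod g = 1" "cmod w < 1"
  shows "schur_step g w = g"
proof -
  have "g * cnj g = 1" using assms by (simp add: complex_norm_square[symmetric])
  then have "g * (1 + cnj g * w) = g + w" by (simp add: algebra_simps)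
  then show ?thesis using schur_step_denom_nz[of g w] assms
    by (simp add: schur_step_def divide_eq_eq)
qed

lemma cmod_sq_complex: "complex_of_real ((cmod a)\<^sup>2) = cnj a * a"
  by (metis complex_norm_square mult.commute of_real_power)

text \<open>Together with \<open>schur_step_diff\<close> this is the invariance of the
  pseudohyperbolic distance |a - b| / |1 - cnj a b|: both right-hand sides carry the factor 1 -
  |g|^2 and denominators of equal modulus. They are kept as two identities because both sides vanish
  for |g| = 1, where the quotient makes no sense.\<close>

lemma schur_step_defect:
  assumes "cmod g \<le> 1" "cmod a < 1" "cmod b < 1"
  shows "1 - cnj (schur_step g a) * schur_step g b
    = of_real (1 - (cmod g)\<^sup>2) * (1 - cnj a * b) / (cnj (1 + cnj g * a) * (1 + cnj g * b))"
proof -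
  have nz: "1 + cnj g * b \<noteq> 0" "cnj (1 + cnj g * a) \<noteq> 0"
    using schur_step_denom_nz[of g b] schur_step_denom_nz[of g a] assms
    by (auto simp del: complex_cnj_add complex_cnj_mult complex_cnj_cnj)
  have "1 - cnj (schur_step g a) * schur_step g b
      = (cnj (1 + cnj g * a) * (1 + cnj g * b) - cnj (g + a) * (g + b)) / (cnj (1 + cnj g * a) * (1 + cnj g * b))"
  proof -
    have "cnj (schur_step g a) * schur_step g b = cnj (g + a) * (g + b) / (cnj (1 + cnj g * a) * (1 + cnj g * b))"
      by (simp add: schur_step_def)
    then show ?thesis using nz by (simp add: diff_divide_distrib del: complex_cnj_add complex_cnj_mult complex_cnj_cnj)
  qed
  also have "cnj (1 + cnj g * a) * (1 + cnj g * b) - cnj (g + a) * (g + b)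
      = of_real (1 - (cmod g)\<^sup>2) * (1 - cnj a * b)"
    by (simp add: cmod_sq_complex of_real_diff algebra_simps del: of_real_power)
  finally show ?thesis .
qed

lemma schur_step_diff:
  assumes "cmod g \<le> 1" "cmod a < 1" "cmod b < 1"
  shows "schur_step g a - schur_step g b
    = of_real (1 - (cmod g)\<^sup>2) * (a - b) / ((1 + cnj g * a) * (1 + cnj g * b))"
proof -
  have nz: "1 + cnj g * b \<noteq> 0" "1 + cnj g * a \<noteq> 0"
    using schur_step_denom_nz[of g b] schur_step_denom_nz[of g a] assms by auto
  have "schur_step g a - schur_step g b
      = ((g + a) * (1 + cnj g * b) - (g + b) * (1 + cnj g * a)) / ((1 + cnj g * a) * (1 + cnj g * b))"
    using nz by (simp add: schur_step_def diff_frac_eq)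
  also have "(g + a) * (1 + cnj g * b) - (g + b) * (1 + cnj g * a) = of_real (1 - (cmod g)\<^sup>2) * (a - b)"
    by (simp add: cmod_sq_complex of_real_diff algebra_simps del: of_real_power)
  finally show ?thesis .
qed

lemma schur_step_defect_norm:
  assumes "cmod g \<le> 1" "cmod a < 1"
  shows "1 - (cmod (schur_step g a))\<^sup>2
    = (1 - (cmod g)\<^sup>2) * (1 - (cmod a)\<^sup>2) / (cmod (1 + cnj g * a))\<^sup>2"
proof -
  have "complex_of_real (1 - (cmod (schur_step g a))\<^sup>2)
      = of_real ((1 - (cmod g)\<^sup>2) * (1 - (cmod a)\<^sup>2) / (cmod (1 + cnj g * a))\<^sup>2)"
    using schur_step_defect[OF assms(1) assms(2) assms(2)]
    by (simp only: of_real_diff of_real_1 of_real_mult of_real_divide cmod_sq_complex)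
  then show ?thesis by (simp only: of_real_eq_iff)
qed

lemma schur_step_norm_le:
  assumes "cmod g \<le> 1" "cmod a < 1"
  shows "cmod (schur_step g a) \<le> 1"
proof -
  have "0 \<le> (1 - (cmod g)\<^sup>2) * (1 - (cmod a)\<^sup>2) / (cmod (1 + cnj g * a))\<^sup>2"
    using assms by (intro divide_nonneg_nonneg mult_nonneg_nonneg) (auto simp: abs_square_le_1)
  then have "(cmod (schur_step g a))\<^sup>2 \<le> 1"
    using schur_step_defect_norm[OF assms] by linarith
  then show ?thesis by (simp add: abs_square_le_1)
qed

text \<open>The pseudohyperbolic distance between r and -r. It is the largest factor by which
  multiplication by z with |z| = r can scale pseudohyperbolic distances.\<close>

definition dilation_factor :: "real \<Rightarrow> real" where
  "dilation_factor r = 2 * r / (1 + r\<^sup>2)"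

lemma dilation_factor_bounds:
  assumes "0 \<le> r" "r < 1"
  shows "0 \<le> dilation_factor r" "dilation_factor r < 1"
proof -
  have p: "0 < 1 + r\<^sup>2" by (simp add: add_pos_nonneg)
  have "0 < (1 - r)\<^sup>2" using assms by simp
  then have "2 * r < 1 + r\<^sup>2" by (simp add: power2_diff)
  then show "dilation_factor r < 1" using p by (simp add: dilation_factor_def)
  show "0 \<le> dilation_factor r" using p assms by (simp add: dilation_factor_def)
qed

lemma dilation_factor_mono:
  assumes "0 \<le> r" "r \<le> s" "s \<le> 1"
  shows "dilation_factor r \<le> dilation_factor s"
proof -
  have p: "0 < 1 + r\<^sup>2" "0 < 1 + s\<^sup>2" by (simp_all add: add_pos_nonneg)
  have "0 \<le> (s - r) * (1 - r * s)" using assms by (intro mult_nonneg_nonneg) (auto simp: mult_le_one)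
  then have "2 * r * (1 + s\<^sup>2) \<le> 2 * s * (1 + r\<^sup>2)" by (simp add: algebra_simps power2_eq_square)
  then show ?thesis unfolding dilation_factor_def using p by (simp add: divide_le_eq pos_le_divide_eq field_simps)
qed

text \<open>The extreme case is w = -1, where equality holds. The difference of the squares is 1 - t
  times an expression affine in |w|^2 and Re w, which decreases in the first, increases in the
  second and vanishes for the values 1 and -1. It is applied with t = |z|^2 and w = cnj a *
  b.\<close>

lemma dilation_defect:
  assumes "cmod w \<le> 1" "0 \<le> t" "t \<le> 1"
  shows "(1 + t) * cmod (1 - w) \<le> 2 * cmod (1 - of_real t * w)"
proof -
  define x where "x = Re w"
  have sq: "(cmod (1 - of_real s * w))\<^sup>2 = 1 - 2 * s * x + s\<^sup>2 * (cmod w)\<^sup>2" for s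
    unfolding cmod_power2 by (simp add: x_def power2_eq_square algebra_simps)
  have xm: "\<bar>x\<bar> \<le> 1" unfolding x_def using abs_Re_le_cmod[of w] assms by linarith
  define m where "m = (cmod w)\<^sup>2"
  have m: "0 \<le> m" "m \<le> 1" using assms by (auto simp: m_def abs_square_le_1)
  have "(2 * cmod (1 - of_real t * w))\<^sup>2 - ((1 + t) * cmod (1 - w))\<^sup>2
     = 4 * (1 - 2 * t * x + t\<^sup>2 * m) - (1 + t)\<^sup>2 * (1 - 2 * x + m)"
    using sq[of t] sq[of 1] by (simp add: power_mult_distrib m_def)
  also have "\<dots> = (1 - t) * ((3 + t) - (1 + 3 * t) * m + 2 * (1 - t) * x)"
    by (simp add: power2_eq_square algebra_simps)
  also have "\<dots> \<ge> 0"
  proof (intro mult_nonneg_nonneg)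
    have "(1 + 3 * t) * m \<le> (1 + 3 * t) * 1" using m assms by (intro mult_left_mono) auto
    moreover have "(1 - t) * (-1) \<le> (1 - t) * x" using xm assms by (intro mult_left_mono) auto
    ultimately show "0 \<le> (3 + t) - (1 + 3 * t) * m + 2 * (1 - t) * x" by (simp add: algebra_simps)
  qed (use assms in auto)
  finally have "((1 + t) * cmod (1 - w))\<^sup>2 \<le> (2 * cmod (1 - of_real t * w))\<^sup>2" by simp
  then show ?thesis by (rule power2_le_imp_le) simp
qed

text \<open>The gain comes from the factor z alone, since the Moebius step preserves the distance or
  is constant. The estimate is cross-multiplied so that it covers points of the unit circle, where 1
  - cnj a * b may be zero.\<close>

lemma schur_step_contraction:
  assumes "cmod g \<le> 1" "cmod a \<le> 1" "cmod b \<le> 1" "cmod z < 1" "0 \<le> c"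
    and le: "cmod (a - b) \<le> c * cmod (1 - cnj a * b)"
  shows "cmod (schur_step g (z * a) - schur_step g (z * b))
    \<le> dilation_factor (cmod z) * c * cmod (1 - cnj (schur_step g (z * a)) * schur_step g (z * b))"
proof -
  let ?r = "cmod z"
  have lt: "cmod (z * x) < 1" if "cmod x \<le> 1" for x
    using that assms mult_left_mono[of "cmod x" 1 "cmod z"] by (simp add: norm_mult)
  have za: "cmod (z * a) < 1" "cmod (z * b) < 1" using lt assms by auto
  let ?D = "cmod (1 + cnj g * (z * a)) * cmod (1 + cnj g * (z * b))"
  have "cnj (z * a) * (z * b) = of_real (?r\<^sup>2) * (cnj a * b)"
    by (simp only: cmod_sq_complex complex_cnj_mult mult_ac)
  then have sq: "of_real (?r\<^sup>2) * (cnj a * b) = cnj (z * a) * (z * b)" ..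
  have "(1 + ?r\<^sup>2) * cmod (1 - cnj a * b) \<le> 2 * cmod (1 - cnj (z * a) * (z * b))"
    using dilation_defect[of "cnj a * b" "?r\<^sup>2", unfolded sq] assms(2-4)
    by (simp add: norm_mult mult_le_one abs_square_le_1 del: complex_cnj_mult of_real_power)
  then have "cmod (1 - cnj a * b) \<le> 2 / (1 + ?r\<^sup>2) * cmod (1 - cnj (z * a) * (z * b))"
    by (simp add: field_simps add_pos_nonneg)
  then have "c * cmod (1 - cnj a * b) \<le> c * (2 / (1 + ?r\<^sup>2) * cmod (1 - cnj (z * a) * (z * b)))"
    using assms by (intro mult_left_mono) auto
  with le have "cmod (a - b) \<le> c * (2 / (1 + ?r\<^sup>2) * cmod (1 - cnj (z * a) * (z * b)))" by linarith
  then have "?r * cmod (a - b) \<le> ?r * (c * (2 / (1 + ?r\<^sup>2) * cmod (1 - cnj (z * a) * (z * b))))"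
    by (intro mult_left_mono) auto
  then have key: "cmod (z * a - z * b) \<le> dilation_factor ?r * c * cmod (1 - cnj (z * a) * (z * b))"
    unfolding right_diff_distrib[symmetric] norm_mult by (simp add: dilation_factor_def mult_ac)
  have gp: "0 \<le> 1 - (cmod g)\<^sup>2" using assms by (simp add: abs_square_le_1)
  have c1: "cmod (schur_step g (z * a) - schur_step g (z * b)) = (1 - (cmod g)\<^sup>2) / ?D * cmod (z * a - z * b)"
    using gp unfolding schur_step_diff[OF assms(1) za] by (simp add: norm_divide norm_mult del: of_real_diff of_real_power)
  have "cmod (cnj (1 + cnj g * (z * a))) = cmod (1 + cnj g * (z * a))" by (rule complex_mod_cnj)
  then have c2: "cmod (1 - cnj (schur_step g (z * a)) * schur_step g (z * b)) = (1 - (cmod g)\<^sup>2) / ?D * cmod (1 - cnj (z * a) * (z * b))"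
    using gp unfolding schur_step_defect[OF assms(1) za]
    by (simp add: norm_divide norm_mult del: of_real_diff of_real_power complex_cnj_add complex_cnj_mult complex_cnj_cnj)
  have "(1 - (cmod g)\<^sup>2) / ?D * cmod (z * a - z * b)
     \<le> (1 - (cmod g)\<^sup>2) / ?D * (dilation_factor ?r * c * cmod (1 - cnj (z * a) * (z * b)))"
    using gp key by (intro mult_left_mono) auto
  then show ?thesis unfolding c1 c2 by (simp add: mult_ac)
qed

section \<open>Finite Schur approximants and their limit\<close>

primrec schur_approx :: "nat \<Rightarrow> (nat \<Rightarrow> complex) \<Rightarrow> complex \<Rightarrow> complex" where
  "schur_approx 0 g z = 0"
| "schur_approx (Suc N) g z = schur_step (g 0) (z * schur_approx N (\<lambda>k. g (Suc k)) z)"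

lemma cmod_mult_less_1:
  assumes "cmod z < 1" "cmod a \<le> 1"
  shows "cmod (z * a) < 1"
  using assms mult_left_mono[of "cmod a" 1 "cmod z"] by (simp add: norm_mult)

lemma schur_approx_norm_le:
  assumes "\<And>k. cmod (g k) \<le> 1" "cmod z < 1"
  shows "cmod (schur_approx N g z) \<le> 1"
  using assms(1)
proof (induction N arbitrary: g)
  case (Suc N)
  have "cmod (schur_approx N (\<lambda>k. g (Suc k)) z) \<le> 1" using Suc by auto
  then show ?case using Suc.prems assms(2) by (auto intro!: schur_step_norm_le cmod_mult_less_1)
qed simp

lemma schur_approx_holomorphic:
  assumes "\<And>k. cmod (g k) \<le> 1"
  shows "schur_approx N g holomorphic_on ball 0 1"
  using assms
proof (induction N arbitrary: g)
  case (Suc N)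
  have h: "schur_approx N (\<lambda>k. g (Suc k)) holomorphic_on ball 0 1" using Suc by auto
  have "1 + cnj (g 0) * (z * schur_approx N (\<lambda>k. g (Suc k)) z) \<noteq> 0" if "z \<in> ball 0 1" for z
    using that Suc.prems by (intro schur_step_denom_nz cmod_mult_less_1 schur_approx_norm_le) auto
  then show ?case using h
    by (auto simp: schur_step_def[abs_def] intro!: holomorphic_intros)
qed (auto simp: schur_approx.simps(1)[abs_def])

text \<open>Both approximants end with the same N steps, each of which contributes one contraction
  factor. What remains inside is a point of the closed disc compared with the 0 of the truncation,
  at pseudohyperbolic distance at most 1.\<close>

lemma schur_approx_close:
  assumes "\<And>k. cmod (g k) \<le> 1" "cmod z < 1"
  shows "cmod (schur_approx (N + M) g z - schur_approx N g z)
    \<le> dilation_factor (cmod z) ^ N * cmod (1 - cnj (schur_approx (N + M) g z) * schur_approx N g z)"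
  using assms(1)
proof (induction N arbitrary: g)
  case 0
  then show ?case using schur_approx_norm_le[of g z M] assms(2) by simp
next
  case (Suc N)
  have "0 \<le> dilation_factor (cmod z)" using dilation_factor_bounds[of "cmod z"] assms by auto
  then show ?case using Suc assms(2)
    by (auto simp: mult.assoc[symmetric] intro!: schur_step_contraction schur_approx_norm_le)
qed

lemma schur_approx_dist:
  assumes "\<And>k. cmod (g k) \<le> 1" "cmod z < 1"
  shows "cmod (schur_approx (N + M) g z - schur_approx N g z) \<le> 2 * dilation_factor (cmod z) ^ N"
proof -
  let ?a = "schur_approx (N + M) g z" and ?b = "schur_approx N g z"
  have "cmod (1 - cnj ?a * ?b) \<le> cmod 1 + cmod (cnj ?a * ?b)" by (rule norm_triangle_ineq4)
  also have "\<dots> \<le> 2" using schur_approx_norm_le[of g z, OF assms] by (simp add: norm_mult mult_le_one)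
  finally have "dilation_factor (cmod z) ^ N * cmod (1 - cnj ?a * ?b) \<le> dilation_factor (cmod z) ^ N * 2"
    using dilation_factor_bounds[of "cmod z"] assms(2) by (intro mult_left_mono) auto
  then show ?thesis using schur_approx_close[of g z N M, OF assms] by linarith
qed

definition schur_limit :: "(nat \<Rightarrow> complex) \<Rightarrow> complex \<Rightarrow> complex" where
  "schur_limit g z = lim (\<lambda>N. schur_approx N g z)"

lemma schur_approx_tendsto:
  assumes "\<And>k. cmod (g k) \<le> 1" "cmod z < 1"
  shows "(\<lambda>N. schur_approx N g z) \<longlonglongrightarrow> schur_limit g z"
proof -
  let ?k = "dilation_factor (cmod z)"
  have k: "0 \<le> ?k" "?k < 1" using dilation_factor_bounds[of "cmod z"] assms by auto
  have "Cauchy (\<lambda>N. schur_approx N g z)"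
  proof (rule CauchyI')
    fix e :: real assume "0 < e"
    have "(\<lambda>N. 2 * ?k ^ N) \<longlonglongrightarrow> 0" using tendsto_mult_right_zero[OF LIMSEQ_realpow_zero[OF k], of 2] by simp
    then obtain K where K: "\<And>N. N \<ge> K \<Longrightarrow> \<bar>2 * ?k ^ N\<bar> < e"
      using \<open>0 < e\<close> unfolding LIMSEQ_def by auto
    have "dist (schur_approx m g z) (schur_approx n g z) < e" if "m \<ge> K" "n > m" for m n
    proof -
      have "cmod (schur_approx (m + (n - m)) g z - schur_approx m g z) \<le> 2 * ?k ^ m"
        by (rule schur_approx_dist[OF assms])
      then show ?thesis using K[OF that(1)] that k by (simp add: dist_norm norm_minus_commute)
    qed
    then show "\<exists>M. \<forall>m\<ge>M. \<forall>n>m. dist (schur_approx m g z) (schur_approx n g z) < e" by blast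
  qed
  then show ?thesis unfolding schur_limit_def using Cauchy_convergent convergent_LIMSEQ_iff by blast
qed

lemma schur_limit_norm_le:
  assumes "\<And>k. cmod (g k) \<le> 1" "cmod z < 1"
  shows "cmod (schur_limit g z) \<le> 1"
proof (rule LIMSEQ_le_const2)
  show "(\<lambda>N. cmod (schur_approx N g z)) \<longlonglongrightarrow> cmod (schur_limit g z)"
    by (intro tendsto_norm schur_approx_tendsto assms)
qed (use schur_approx_norm_le[of g z, OF assms] in auto)

lemma schur_limit_rec:
  assumes "\<And>k. cmod (g k) \<le> 1" "cmod z < 1"
  shows "schur_limit g z = schur_step (g 0) (z * schur_limit (\<lambda>k. g (Suc k)) z)"
proof -
  let ?s = "\<lambda>k. g (Suc k)"
  have t: "(\<lambda>N. schur_approx N ?s z) \<longlonglongrightarrow> schur_limit ?s z" using assms by (intro schur_approx_tendsto) auto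
  have "1 + cnj (g 0) * (z * schur_limit ?s z) \<noteq> 0"
    using assms by (intro schur_step_denom_nz cmod_mult_less_1 schur_limit_norm_le) auto
  then have "(\<lambda>N. schur_approx (Suc N) g z) \<longlonglongrightarrow> schur_step (g 0) (z * schur_limit ?s z)"
    unfolding schur_approx.simps schur_step_def by (intro tendsto_intros t)
  moreover have "(\<lambda>N. schur_approx (Suc N) g z) \<longlonglongrightarrow> schur_limit g z"
    using schur_approx_tendsto[OF assms] by (rule LIMSEQ_Suc)
  ultimately show ?thesis using LIMSEQ_unique by blast
qed

lemma schur_limit_0:
  assumes "\<And>k. cmod (g k) \<le> 1"
  shows "schur_limit g 0 = g 0"
  using schur_limit_rec[of g 0, OF assms] by (simp add: schur_step_def)

lemma schur_limit_holomorphic: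
  assumes "\<And>k. cmod (g k) \<le> 1"
  shows "schur_limit g holomorphic_on ball 0 1"
proof (rule holomorphic_uniform_sequence[where f = "\<lambda>N. schur_approx N g"])
  fix x :: complex assume x: "x \<in> ball 0 1"
  \<comment> \<open>\<open>r\<close> is the midpoint between |x| and 1, and \<open>d\<close> is the
    distance from |x| to it, so \<open>cball x d\<close> stays in |z| \<le> r. By monotonicity the
    contraction factor at r then gives one geometric rate on the whole ball.\<close>
  define d where "d = (1 - cmod x) / 2"
  define r where "r = (1 + cmod x) / 2"
  have d: "0 < d" "0 \<le> r" "r < 1" using x by (auto simp: d_def r_def)
  have sub: "cmod z \<le> r" if "z \<in> cball x d" for z
    using that norm_triangle_sub[of z x] by (auto simp: d_def r_def dist_norm norm_minus_commute field_simps)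
  have "uniform_limit (cball x d) (\<lambda>N. schur_approx N g) (schur_limit g) sequentially"
    unfolding uniform_limit_sequentially_iff
  proof (intro allI impI)
    fix e :: real assume "0 < e"
    have "(\<lambda>N. 2 * dilation_factor r ^ N) \<longlonglongrightarrow> 0"
      using tendsto_mult_right_zero[OF LIMSEQ_realpow_zero[OF dilation_factor_bounds[OF d(2,3)]], of 2] by simp
    then obtain K where K: "\<And>N. N \<ge> K \<Longrightarrow> \<bar>2 * dilation_factor r ^ N\<bar> < e"
      using \<open>0 < e\<close> unfolding LIMSEQ_def by auto
    have "dist (schur_approx n g z) (schur_limit g z) < e" if n: "n \<ge> K" and z: "z \<in> cball x d" for n z
    proof -
      have z1: "cmod z < 1" "cmod z \<le> r" using sub[OF z] d by auto
      have "(\<lambda>M. cmod (schur_approx (n + M) g z - schur_approx n g z)) \<longlonglongrightarrow> cmod (schur_limit g z - schur_approx n g z)"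
        using LIMSEQ_ignore_initial_segment[OF schur_approx_tendsto[of g z, OF assms z1(1)], of n]
        by (intro tendsto_intros) (simp add: add.commute)
      then have "cmod (schur_limit g z - schur_approx n g z) \<le> 2 * dilation_factor (cmod z) ^ n"
        by (rule LIMSEQ_le_const2) (use schur_approx_dist[of g z, OF assms z1(1)] in auto)
      also have "\<dots> \<le> 2 * dilation_factor r ^ n"
        using dilation_factor_mono[of "cmod z" r] dilation_factor_bounds[of "cmod z"] z1 d by (simp add: power_mono)
      also have "\<dots> < e" using K[OF n] by simp
      finally show ?thesis by (simp add: dist_norm norm_minus_commute)
    qed
    then show "\<exists>N. \<forall>n\<ge>N. \<forall>z\<in>cball x d. dist (schur_approx n g z) (schur_limit g z) < e" by blast
  qed
  moreover have "cball x d \<subseteq> ball 0 1" using sub d by fastforce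
  ultimately show "\<exists>d>0. cball x d \<subseteq> ball 0 1 \<and> uniform_limit (cball x d) (\<lambda>N. schur_approx N g) (schur_limit g) sequentially"
    using d by blast
qed (use assms schur_approx_holomorphic in auto)

section \<open>Existence and uniqueness for prescribed Schur parameters\<close>

lemma schur_step_inverse:
  assumes "cmod g < 1" "cmod f \<le> 1" "w = (f - g) / (1 - cnj g * f)"
  shows "f = (g + w) / (1 + cnj g * w)"
proof -
  have "cmod (cnj g * f) < 1" using assms cmod_mult_less_1[of "cnj g" f] by simp
  then have nz: "1 - cnj g * f \<noteq> 0" by auto
  have g1: "of_real (1 - (cmod g)\<^sup>2) \<noteq> (0::complex)"
    using assms by (simp add: abs_square_eq_1 flip: of_real_power)
  have w: "w * (1 - cnj g * f) = f - g" using nz assms by simp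
  have e: "(1 + cnj g * w) * (1 - cnj g * f) = of_real (1 - (cmod g)\<^sup>2)"
  proof -
    have "(1 + cnj g * w) * (1 - cnj g * f) = (1 - cnj g * f) + cnj g * (w * (1 - cnj g * f))"
      by (simp add: algebra_simps)
    then show ?thesis
      unfolding w by (simp add: cmod_sq_complex of_real_diff algebra_simps del: of_real_power)
  qed
  then have nz2: "1 + cnj g * w \<noteq> 0" using g1 by auto
  have "f * (1 + cnj g * w) = g + w" using w by (simp add: algebra_simps)
  then show "f = (g + w) / (1 + cnj g * w)" using nz2 by (simp add: eq_divide_eq)
qed

text \<open>The n-th Schur iterate is the limit function of the parameters shifted by n. It is
  defined for all n, also beyond a unimodular parameter, where nothing is demanded of it.\<close>

lemma has_schur_parameters_limit:
  assumes "\<And>k. cmod (g k) \<le> 1"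
  shows "has_schur_parameters (schur_limit g) g"
proof -
  define F where "F = (\<lambda>n. schur_limit (\<lambda>k. g (n + k)))"
  have F0: "F n 0 = g n" for n using schur_limit_0[of "\<lambda>k. g (n + k)"] assms by (simp add: F_def)
  have Fs: "schur_function (F n)" for n
    using schur_limit_holomorphic[of "\<lambda>k. g (n + k)"] schur_limit_norm_le[of "\<lambda>k. g (n + k)"] assms
    by (simp add: F_def schur_function_def)
  have rec: "F n z = schur_step (g n) (z * F (Suc n) z)" if "cmod z < 1" for n z
    using schur_limit_rec[of "\<lambda>k. g (n + k)" z] assms that by (simp add: F_def)
  have w1: "cmod (z * F (Suc n) z) < 1" if "cmod z < 1" for n z
    using that Fs[of "Suc n"] by (intro cmod_mult_less_1) (auto simp: schur_function_def)
  have step: "z * F (Suc n) z = (F n z - g n) / (1 - cnj (g n) * F n z)"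
    if "cmod z < 1" "cmod (g n) < 1" for n z
  proof -
    let ?w = "z * F (Suc n) z"
    have nz: "1 + cnj (g n) * ?w \<noteq> 0" using that w1[OF that(1)] by (intro schur_step_denom_nz) auto
    have e: "F n z * (1 + cnj (g n) * ?w) = g n + ?w"
      using rec[OF that(1), of n] nz by (simp add: schur_step_def)
    have "cmod (cnj (g n) * F n z) < 1" using that Fs[of n] cmod_mult_less_1[of "cnj (g n)" "F n z"]
      by (simp add: schur_function_def)
    then have "1 - cnj (g n) * F n z \<noteq> 0" by auto
    moreover have "?w * (1 - cnj (g n) * F n z) = F n z - g n" using e by (simp add: algebra_simps)
    ultimately show ?thesis by (simp add: eq_divide_eq)
  qed
  have stop: "F n z = g n" if "cmod z < 1" "\<not> cmod (g n) < 1" for n z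
    using rec[OF that(1), of n] schur_step_boundary[OF _ w1[OF that(1)], of "g n"] that assms[of n] by simp
  have "\<forall>n. (\<forall>k<n. cmod (g k) < 1) \<longrightarrow> schur_function (F n) \<and> F n 0 = g n \<and>
      (if cmod (g n) < 1 then \<forall>z\<in>ball 0 1. z * F (Suc n) z = (F n z - g n) / (1 - cnj (g n) * F n z)
       else \<forall>z\<in>ball 0 1. F n z = g n)"
    by (auto intro: F0 Fs step stop)
  moreover have "F 0 = schur_limit g" by (simp add: F_def)
  ultimately show ?thesis unfolding has_schur_parameters_def by blast
qed

text \<open>The contraction argument again, now for an arbitrary function with the given parameters:
  peeling off one step replaces f by its first iterate and shifts the parameters. It forces any such
  f to agree with the limit on the disc, so the choice made in \<open>schur_fun\<close> is
  immaterial there.\<close>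

lemma has_schur_parameters_approx:
  assumes "\<And>k. cmod (g k) \<le> 1" "cmod z < 1" "has_schur_parameters f g"
  shows "cmod (f z - schur_approx N g z) \<le> dilation_factor (cmod z) ^ N * cmod (1 - cnj (f z) * schur_approx N g z)"
  using assms(1,3)
proof (induction N arbitrary: f g)
  case 0
  then have "cmod (f z) \<le> 1" using assms(2) by (auto simp: has_schur_parameters_def schur_function_def)
  then show ?case by simp
next
  case (Suc N)
  let ?s = "\<lambda>k. g (Suc k)"
  obtain F where F: "F 0 = f" and
    Fn: "\<And>n. (\<forall>k<n. cmod (g k) < 1) \<Longrightarrow> schur_function (F n) \<and> F n 0 = g n \<and>
      (if cmod (g n) < 1 then \<forall>z\<in>ball 0 1. z * F (Suc n) z = (F n z - g n) / (1 - cnj (g n) * F n z)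
       else \<forall>z\<in>ball 0 1. F n z = g n)"
    using Suc.prems(2) unfolding has_schur_parameters_def by blast
  have f1: "cmod (f z) \<le> 1" using Fn[of 0] F assms(2) by (auto simp: schur_function_def)
  have b1: "cmod (schur_approx N ?s z) \<le> 1" using Suc.prems assms(2) by (intro schur_approx_norm_le) auto
  show ?case
  proof (cases "cmod (g 0) < 1")
    case True
    have sh: "has_schur_parameters (F 1) ?s"
      unfolding has_schur_parameters_def
    proof (intro exI[of _ "\<lambda>n. F (Suc n)"] conjI allI impI)
      fix n assume h: "\<forall>k<n. cmod (g (Suc k)) < 1"
      then have "\<forall>k<Suc n. cmod (g k) < 1" using True by (auto simp: less_Suc_eq_0_disj)
      from Fn[OF this] show "schur_function (F (Suc n))" "F (Suc n) 0 = g (Suc n)"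
        "if cmod (g (Suc n)) < 1 then \<forall>z\<in>ball 0 1. z * F (Suc (Suc n)) z = (F (Suc n) z - g (Suc n)) / (1 - cnj (g (Suc n)) * F (Suc n) z)
         else \<forall>z\<in>ball 0 1. F (Suc n) z = g (Suc n)" by auto
    qed simp
    have F1: "cmod (F 1 z) \<le> 1" using Fn[of 1] True assms(2) by (auto simp: schur_function_def)
    have IH: "cmod (F 1 z - schur_approx N ?s z) \<le> dilation_factor (cmod z) ^ N * cmod (1 - cnj (F 1 z) * schur_approx N ?s z)"
      using Suc.IH[of ?s "F 1"] sh Suc.prems by auto
    have "z * F 1 z = (f z - g 0) / (1 - cnj (g 0) * f z)" using Fn[of 0] True assms(2) F by auto
    from schur_step_inverse[OF True f1 this] have "f z = schur_step (g 0) (z * F 1 z)"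
      by (simp add: schur_step_def)
    moreover have "0 \<le> dilation_factor (cmod z)" using dilation_factor_bounds[of "cmod z"] assms by auto
    ultimately show ?thesis
      using schur_step_contraction[OF Suc.prems(1)[of 0] F1 b1 assms(2) _ IH] by simp
  next
    case False
    then have "f z = g 0" using Fn[of 0] F assms(2) by auto
    moreover have "schur_approx (Suc N) g z = g 0"
      using False Suc.prems(1)[of 0] b1 assms(2) by (simp add: schur_step_boundary cmod_mult_less_1)
    ultimately show ?thesis
      using dilation_factor_bounds[of "cmod z"] assms(2) by (simp del: schur_approx.simps)
  qed
qed

lemma has_schur_parameters_unique:
  assumes "\<And>k. cmod (g k) \<le> 1" "cmod z < 1" "has_schur_parameters f g"
  shows "f z = schur_limit g z"
proof -
  let ?k = "dilation_factor (cmod z)"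
  have k: "0 \<le> ?k" "?k < 1" using dilation_factor_bounds[of "cmod z"] assms by auto
  have f1: "cmod (f z) \<le> 1" using assms(2,3) by (auto simp: has_schur_parameters_def schur_function_def)
  have "cmod (f z - schur_approx N g z) \<le> ?k ^ N * 2" for N
  proof -
    have "cmod (1 - cnj (f z) * schur_approx N g z) \<le> cmod 1 + cmod (cnj (f z) * schur_approx N g z)"
      by (rule norm_triangle_ineq4)
    also have "\<dots> \<le> 2" using schur_approx_norm_le[OF assms(1,2)] f1 by (simp add: norm_mult mult_le_one)
    finally have "?k ^ N * cmod (1 - cnj (f z) * schur_approx N g z) \<le> ?k ^ N * 2"
      using k by (intro mult_left_mono) auto
    then show ?thesis using has_schur_parameters_approx[OF assms, of N] by linarith
  qed
  moreover have "(\<lambda>N. ?k ^ N * 2) \<longlonglongrightarrow> 0" using tendsto_mult_left_zero[OF LIMSEQ_realpow_zero[OF k], of 2] by simp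
  ultimately have "(\<lambda>N. f z - schur_approx N g z) \<longlonglongrightarrow> 0"
    by (intro Lim_null_comparison[of "\<lambda>N. f z - schur_approx N g z" "\<lambda>N. ?k ^ N * 2"] always_eventually allI)
  moreover have "(\<lambda>N. f z - schur_approx N g z) \<longlonglongrightarrow> f z - schur_limit g z"
    by (intro tendsto_intros schur_approx_tendsto assms)
  ultimately have "f z - schur_limit g z = 0" by (rule LIMSEQ_unique[rotated])
  then show ?thesis by simp
qed

lemma schur_fun_eq_limit:
  assumes "\<And>k. cmod (g k) \<le> 1" "cmod z < 1"
  shows "schur_fun g z = schur_limit g z"
  unfolding schur_fun_def
  by (rule has_schur_parameters_unique[OF assms])
    (rule someI[of "\<lambda>f. has_schur_parameters f g", OF has_schur_parameters_limit[OF assms(1)]])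

lemma schur_fun_norm_le:
  assumes "\<And>k. cmod (g k) \<le> 1" "cmod z < 1"
  shows "cmod (schur_fun g z) \<le> 1"
  by (simp only: schur_fun_eq_limit[of g, OF assms] schur_limit_norm_le[of g, OF assms])

lemma schur_fun_0:
  assumes "\<And>k. cmod (g k) \<le> 1"
  shows "schur_fun g 0 = g 0"
  using schur_fun_eq_limit[of g 0] schur_limit_0 assms by simp

lemma schur_fun_holomorphic:
  assumes "\<And>k. cmod (g k) \<le> 1"
  shows "schur_fun g holomorphic_on ball 0 1"
  using schur_limit_holomorphic[OF assms]
  by (rule holomorphic_transform) (use schur_fun_eq_limit assms in simp)

lemma schur_fun_rec:
  assumes "\<And>k. cmod (g k) \<le> 1" "cmod z < 1"
  shows "schur_fun g z = schur_step (g 0) (z * schur_fun (\<lambda>k. g (Suc k)) z)"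
proof -
  have "schur_fun (\<lambda>k. g (Suc k)) z = schur_limit (\<lambda>k. g (Suc k)) z"
    using assms by (intro schur_fun_eq_limit) auto
  then show ?thesis
    by (simp only: schur_fun_eq_limit[of g, OF assms] schur_limit_rec[of g, OF assms])
qed

section \<open>The resolvent of the CMV matrix\<close>

lemma rho_cnj [simp]: "rho (cnj a) = rho a" and rho_minus [simp]: "rho (- a) = rho a"
  by (simp_all add: rho_def)

lemma rho_sq:
  assumes "cmod a \<le> 1"
  shows "complex_of_real (rho a) * of_real (rho a) = 1 - cnj a * a"
proof -
  have "rho a * rho a = 1 - (cmod a)\<^sup>2"
    using assms by (simp add: rho_def abs_square_le_1)
  then have "complex_of_real (rho a * rho a) = of_real (1 - (cmod a)\<^sup>2)" by simp
  then show ?thesis by (simp only: of_real_mult of_real_diff of_real_1 cmod_sq_complex)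
qed

lemma rho_power2:
  assumes "cmod a \<le> 1"
  shows "(rho a)\<^sup>2 = 1 - (cmod a)\<^sup>2"
  using assms by (simp add: rho_def abs_square_le_1)

lemma cmv_block_components:
  "cmv_block \<alpha> j u $ 1 = cnj (\<alpha> j) * u j + of_real (rho (\<alpha> j)) * u (j + 1)"
  "cmv_block \<alpha> j u $ 2 = of_real (rho (\<alpha> j)) * u j - \<alpha> j * u (j + 1)"
  by (simp_all add: cmv_block_def Theta_def matrix_vector_mult_def sum_2)

lemma cmv_L_even:
  assumes "even j"
  shows "cmv_L \<alpha> u j = cnj (\<alpha> j) * u j + of_real (rho (\<alpha> j)) * u (j + 1)"
    and "cmv_L \<alpha> u (j + 1) = of_real (rho (\<alpha> j)) * u j - \<alpha> j * u (j + 1)"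
  using assms by (simp_all add: cmv_L_def cmv_block_components)

lemma cmv_M_odd:
  assumes "odd j"
  shows "cmv_M \<alpha> u j = cnj (\<alpha> j) * u j + of_real (rho (\<alpha> j)) * u (j + 1)"
    and "cmv_M \<alpha> u (j + 1) = of_real (rho (\<alpha> j)) * u j - \<alpha> j * u (j + 1)"
  using assms by (simp_all add: cmv_M_def cmv_block_components)

lemma even_pair_cases:
  fixes k :: int
  obtains j where "even j" "k = j" | j where "even j" "k = j + 1"
  by (metis add_diff_cancel_right' diff_add_cancel even_plus_one_iff)

lemma odd_pair_cases:
  fixes k :: int
  obtains j where "odd j" "k = j" | j where "odd j" "k = j + 1"
  by (metis diff_add_cancel even_plus_one_iff)

text \<open>\<open>Theta a\<close> is unitary and symmetric, so its inverse is its entrywise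
  conjugate \<open>Theta (cnj a)\<close>. Consequently L and M are inverted by the same operators
  with conjugated coefficients.\<close>

lemma Theta_block_inverse:
  assumes "cmod a \<le> 1"
  shows "cnj a * (a * x + of_real (rho a) * y) + of_real (rho a) * (of_real (rho a) * x - cnj a * y) = x"
    and "of_real (rho a) * (a * x + of_real (rho a) * y) - a * (of_real (rho a) * x - cnj a * y) = y"
proof -
  have "cnj a * (a * x + of_real (rho a) * y) + of_real (rho a) * (of_real (rho a) * x - cnj a * y)
      = (cnj a * a + of_real (rho a) * of_real (rho a)) * x" by (simp add: algebra_simps)
  then show "cnj a * (a * x + of_real (rho a) * y) + of_real (rho a) * (of_real (rho a) * x - cnj a * y) = x"
    unfolding rho_sq[OF assms] by simp
  have "of_real (rho a) * (a * x + of_real (rho a) * y) - a * (of_real (rho a) * x - cnj a * y)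
      = (cnj a * a + of_real (rho a) * of_real (rho a)) * y" by (simp add: algebra_simps)
  then show "of_real (rho a) * (a * x + of_real (rho a) * y) - a * (of_real (rho a) * x - cnj a * y) = y"
    unfolding rho_sq[OF assms] by simp
qed

lemma cmv_L_inverse:
  assumes "\<And>k. cmod (\<alpha> k) \<le> 1"
  shows "cmv_L \<alpha> (cmv_L (\<lambda>k. cnj (\<alpha> k)) u) = u"
proof
  fix k
  show "cmv_L \<alpha> (cmv_L (\<lambda>k. cnj (\<alpha> k)) u) k = u k"
    by (rule even_pair_cases[of k]) (use assms in \<open>simp_all add: cmv_L_even Theta_block_inverse\<close>)
qed

lemma cmv_M_inverse:
  assumes "\<And>k. cmod (\<alpha> k) \<le> 1"
  shows "cmv_M \<alpha> (cmv_M (\<lambda>k. cnj (\<alpha> k)) u) = u"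
proof
  fix k
  show "cmv_M \<alpha> (cmv_M (\<lambda>k. cnj (\<alpha> k)) u) k = u k"
    by (rule odd_pair_cases[of k]) (use assms in \<open>simp_all add: cmv_M_odd Theta_block_inverse\<close>)
qed

text \<open>Each row has at most two nonzero entries, so coordinatewise convergence is enough to
  pass L through an infinite sum.\<close>

lemma cmv_L_sums:
  assumes "\<And>k. (\<lambda>m. f m k) sums u k"
  shows "(\<lambda>m. cmv_L \<alpha> (f m) k) sums cmv_L \<alpha> u k"
  by (rule even_pair_cases[of k])
    (auto simp: cmv_L_even intro!: sums_add sums_diff sums_mult assms)

lemma cmv_M_sums:
  assumes "\<And>k. (\<lambda>m. f m k) sums u k"
  shows "(\<lambda>m. cmv_M \<alpha> (f m) k) sums cmv_M \<alpha> u k"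
  by (rule odd_pair_cases[of k])
    (auto simp: cmv_M_odd intro!: sums_add sums_diff sums_mult assms)

lemma cmv_L_scale: "cmv_L \<alpha> (\<lambda>k. c * u k) k = c * cmv_L \<alpha> u k"
  by (rule even_pair_cases[of k]) (simp_all add: cmv_L_even algebra_simps)

lemma cmv_M_scale: "cmv_M \<alpha> (\<lambda>k. c * u k) k = c * cmv_M \<alpha> u k"
  by (rule odd_pair_cases[of k]) (simp_all add: cmv_M_odd algebra_simps)

lemma cmv_scale: "cmv \<alpha> (\<lambda>k. c * u k) k = c * cmv \<alpha> u k"
  by (simp add: cmv_def cmv_M_scale[abs_def] cmv_L_scale)

lemma cmv_L_diff: "cmv_L \<alpha> (\<lambda>k. u k - v k) k = cmv_L \<alpha> u k - cmv_L \<alpha> v k"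
  by (rule even_pair_cases[of k]) (simp_all add: cmv_L_even algebra_simps)

lemma cmv_M_diff: "cmv_M \<alpha> (\<lambda>k. u k - v k) k = cmv_M \<alpha> u k - cmv_M \<alpha> v k"
  by (rule odd_pair_cases[of k]) (simp_all add: cmv_M_odd algebra_simps)

lemma cmv_diff: "cmv \<alpha> (\<lambda>k. u k - v k) k = cmv \<alpha> u k - cmv \<alpha> v k"
  by (simp add: cmv_def cmv_M_diff[abs_def] cmv_L_diff)

text \<open>The squared norm with values in \<open>ennreal\<close>, so that regrouping and
  exchanging sums carry no summability conditions, and membership in \<open>ell2\<close> is read off
  at the end as finiteness.\<close>

definition ell2_energy :: "(int \<Rightarrow> complex) \<Rightarrow> ennreal" where
  "ell2_energy u = (\<integral>\<^sup>+k. ennreal ((cmod (u k))\<^sup>2) \<partial>count_space UNIV)"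

lemma ell2_iff_energy: "u \<in> ell2 \<longleftrightarrow> ell2_energy u < \<infinity>"
proof -
  have "u \<in> ell2 \<longleftrightarrow> integrable (count_space UNIV) (\<lambda>k. (cmod (u k))\<^sup>2)"
    using abs_summable_equivalent[of "\<lambda>k. (cmod (u k))\<^sup>2" UNIV]
    unfolding Infinite_Set_Sum.abs_summable_on_def by (simp add: ell2_def)
  then show ?thesis by (simp add: ell2_energy_def integrable_iff_bounded)
qed

text \<open>The shift p selects the pairing of the blocks: 0 for L and 1 for M.\<close>

lemma nn_integral_int_pairs:
  fixes g :: "int \<Rightarrow> ennreal" and p :: int
  shows "(\<integral>\<^sup>+k. g k \<partial>count_space UNIV) = (\<integral>\<^sup>+i. g (2 * i + p) + g (2 * i + p + 1) \<partial>count_space UNIV)"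
proof -
  let ?A = "range (\<lambda>i::int. 2 * i + p)" and ?B = "range (\<lambda>i::int. 2 * i + p + 1)"
  have AB: "?B = - ?A"
  proof (intro set_eqI iffI)
    fix k assume "k \<in> ?B" then show "k \<in> - ?A" by auto presburger
  next
    fix k assume k: "k \<in> - ?A"
    have "k = 2 * ((k - p) div 2) + p \<or> k = 2 * ((k - p) div 2) + p + 1" by presburger
    then show "k \<in> ?B" using k by blast
  qed
  have bA: "bij_betw (\<lambda>i::int. 2 * i + p) UNIV ?A" and bB: "bij_betw (\<lambda>i::int. 2 * i + p + 1) UNIV ?B"
    by (auto intro!: inj_on_imp_bij_betw injI)
  have "(\<integral>\<^sup>+k. g k \<partial>count_space UNIV) = (\<integral>\<^sup>+k. g k * indicator ?A k + g k * indicator ?B k \<partial>count_space UNIV)"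
    unfolding AB by (intro nn_integral_cong) (simp split: split_indicator)
  also have "\<dots> = (\<integral>\<^sup>+k. g k \<partial>count_space ?A) + (\<integral>\<^sup>+k. g k \<partial>count_space ?B)"
    by (simp add: nn_integral_add nn_integral_count_space_indicator)
  also have "\<dots> = (\<integral>\<^sup>+i. g (2 * i + p) \<partial>count_space UNIV) + (\<integral>\<^sup>+i. g (2 * i + p + 1) \<partial>count_space UNIV)"
    using nn_integral_bij_count_space[OF bA, of g] nn_integral_bij_count_space[OF bB, of g] by simp
  also have "\<dots> = (\<integral>\<^sup>+i. g (2 * i + p) + g (2 * i + p + 1) \<partial>count_space UNIV)"
    by (simp add: nn_integral_add)
  finally show ?thesis .
qed

lemma Theta_block_isometry:
  assumes "cmod a \<le> 1"
  shows "(cmod (cnj a * x + of_real (rho a) * y))\<^sup>2 + (cmod (of_real (rho a) * x - a * y))\<^sup>2 = (cmod x)\<^sup>2 + (cmod y)\<^sup>2"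
proof -
  let ?r = "complex_of_real (rho a)"
  have "complex_of_real ((cmod (cnj a * x + ?r * y))\<^sup>2 + (cmod (?r * x - a * y))\<^sup>2)
      = (cnj a * a + ?r * ?r) * (cnj x * x + cnj y * y)"
    unfolding of_real_add cmod_sq_complex by (simp add: algebra_simps)
  also have "\<dots> = complex_of_real ((cmod x)\<^sup>2 + (cmod y)\<^sup>2)"
    unfolding rho_sq[OF assms] of_real_add cmod_sq_complex by simp
  finally show ?thesis by (simp only: of_real_eq_iff)
qed

lemma ell2_energy_cmv_L:
  assumes "\<And>k. cmod (\<alpha> k) \<le> 1"
  shows "ell2_energy (cmv_L \<alpha> u) = ell2_energy u"
  unfolding ell2_energy_def
  by (subst (1 2) nn_integral_int_pairs[where p = 0])
    (simp add: cmv_L_even Theta_block_isometry assms flip: ennreal_plus)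

lemma ell2_energy_cmv_M:
  assumes "\<And>k. cmod (\<alpha> k) \<le> 1"
  shows "ell2_energy (cmv_M \<alpha> u) = ell2_energy u"
proof -
  have "ennreal ((cmod (cmv_M \<alpha> u (2 * i + 1)))\<^sup>2) + ennreal ((cmod (cmv_M \<alpha> u (2 * i + 1 + 1)))\<^sup>2)
      = ennreal ((cmod (u (2 * i + 1)))\<^sup>2) + ennreal ((cmod (u (2 * i + 1 + 1)))\<^sup>2)" for i
  proof -
    have o: "odd (2 * i + 1)" by simp
    show ?thesis
      unfolding cmv_M_odd[OF o] ennreal_plus[OF zero_le_power2 zero_le_power2, symmetric]
        Theta_block_isometry[OF assms] ..
  qed
  then show ?thesis
    unfolding ell2_energy_def by (subst (1 2) nn_integral_int_pairs[where p = 1]) (simp only:)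
qed

lemma ell2_energy_delta: "ell2_energy (delta n) = 1"
proof -
  have "ell2_energy (delta n) = (\<integral>\<^sup>+k. indicator {n} k \<partial>count_space UNIV)"
    unfolding ell2_energy_def by (intro nn_integral_cong) (simp add: delta_def)
  then show ?thesis by simp
qed

lemma ell2_tendsto_0:
  assumes "u \<in> ell2" and "inj (h :: nat \<Rightarrow> int)"
  shows "(\<lambda>i. u (h i)) \<longlonglongrightarrow> 0"
proof -
  have "(\<lambda>k. (cmod (u k))\<^sup>2) summable_on range h"
    using assms(1) by (auto simp: ell2_def intro: summable_on_subset_banach)
  then have "(\<lambda>i. (cmod (u (h i)))\<^sup>2) summable_on UNIV"
    using summable_on_reindex[OF assms(2), of "\<lambda>k. (cmod (u k))\<^sup>2"] by (simp add: o_def)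
  then have "(\<lambda>i. (cmod (u (h i)))\<^sup>2) \<longlonglongrightarrow> 0"
    by (intro summable_LIMSEQ_zero summable_on_imp_summable)
  then have "(\<lambda>i. sqrt ((cmod (u (h i)))\<^sup>2)) \<longlonglongrightarrow> sqrt 0" by (rule tendsto_real_sqrt)
  then show ?thesis by (simp add: tendsto_norm_zero_iff)
qed

lemma ell2_diff:
  assumes "u \<in> ell2" "v \<in> ell2"
  shows "(\<lambda>k. u k - v k) \<in> ell2"
proof -
  have le: "(cmod (a - b))\<^sup>2 \<le> 2 * (cmod a)\<^sup>2 + 2 * (cmod b)\<^sup>2" for a b :: complex
  proof -
    have "(cmod (a - b))\<^sup>2 \<le> (cmod a + cmod b)\<^sup>2" by (intro power_mono norm_triangle_ineq4) auto
    also have "\<dots> \<le> 2 * (cmod a)\<^sup>2 + 2 * (cmod b)\<^sup>2"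
      using sum_squares_bound[of "cmod a" "cmod b"] by (simp add: power2_sum)
    finally show ?thesis .
  qed
  have "(\<lambda>k. 2 * (cmod (u k))\<^sup>2 + 2 * (cmod (v k))\<^sup>2) summable_on UNIV"
    using assms by (intro summable_on_add summable_on_cmult_right) (auto simp: ell2_def)
  then have "(\<lambda>k. (cmod (u k - v k))\<^sup>2) summable_on UNIV"
    by (rule summable_on_comparison_test) (use le in auto)
  then show ?thesis by (simp add: ell2_def)
qed

section \<open>The resolvent as a Neumann series\<close>

lemma cmv_resolvent_exists:
  assumes a: "\<And>k. cmod (\<alpha> k) \<le> 1" and z: "cmod z < 1"
  obtains \<psi> where "\<psi> \<in> ell2" "\<And>k. cmv \<alpha> \<psi> k - z * \<psi> k = delta n k"
proof -
  define V where "V = (\<lambda>u. cmv_M (\<lambda>k. cnj (\<alpha> k)) (cmv_L (\<lambda>k. cnj (\<alpha> k)) u))"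
  \<comment> \<open>\<open>V\<close> inverts E, and (E - z)^-1 is the sum of z^m E^-(m+1); hence the
    exponent \<open>Suc m\<close>.\<close>
  define u where "u = (\<lambda>m. (V ^^ Suc m) (delta n))"
  have EV: "cmv \<alpha> (V x) = x" for x
    by (simp add: cmv_def V_def cmv_M_inverse[OF a] cmv_L_inverse[OF a])
  have E0: "cmv \<alpha> (u 0) = delta n" and ES: "cmv \<alpha> (u (Suc m)) = u m" for m
    by (simp_all add: u_def EV)
  have VN: "ell2_energy (V x) = ell2_energy x" for x
    by (simp add: V_def ell2_energy_cmv_M ell2_energy_cmv_L a)
  have uN: "ell2_energy (u m) = 1" for m
    unfolding u_def by (induction m) (simp_all add: VN ell2_energy_delta)
  \<comment> \<open>An entry is bounded by the norm, which is 1; this gives absolute convergence of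
    the series in each coordinate.\<close>
  have ub: "cmod (u m k) \<le> 1" for m k
  proof -
    have "ennreal ((cmod (u m k))\<^sup>2) = (\<integral>\<^sup>+j. ennreal ((cmod (u m j))\<^sup>2) * indicator {k} j \<partial>count_space UNIV)"
      by (simp add: nn_integral_indicator_singleton)
    also have "\<dots> \<le> ell2_energy (u m)"
      unfolding ell2_energy_def by (intro nn_integral_mono) (simp split: split_indicator)
    finally have "(cmod (u m k))\<^sup>2 \<le> 1" by (simp add: uN)
    then show ?thesis by (simp add: abs_square_le_1)
  qed
  define C where "C = 1 / (1 - cmod z)"
  have C: "0 < C" using z by (simp add: C_def)
  have geo: "(\<lambda>m. cmod z ^ m) sums C" using geometric_sums[of "cmod z"] z by (simp add: C_def)
  have sumabs: "summable (\<lambda>m. cmod z ^ m * cmod (u m k))" for k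
    by (rule summable_comparison_test[OF _ sums_summable[OF geo]])
      (use ub in \<open>auto intro!: exI[of _ 0] mult_left_le\<close>)
  define \<psi> where "\<psi> = (\<lambda>k. \<Sum>m. z ^ m * u m k)"
  have \<psi>: "(\<lambda>m. z ^ m * u m k) sums \<psi> k" for k
    unfolding \<psi>_def by (rule summable_sums, rule summable_norm_cancel) (use sumabs in \<open>simp add: norm_mult norm_power\<close>)
  have "cmv \<alpha> \<psi> k - z * \<psi> k = delta n k" for k
  proof -
    have "(\<lambda>m. cmv \<alpha> (\<lambda>k. z ^ m * u m k) k) sums cmv \<alpha> \<psi> k"
      unfolding cmv_def by (rule cmv_L_sums, rule cmv_M_sums, rule \<psi>)
    then have "(\<lambda>m. z ^ m * cmv \<alpha> (u m) k) sums cmv \<alpha> \<psi> k" by (simp add: cmv_scale)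
    moreover have "(\<lambda>m. z ^ m * cmv \<alpha> (u m) k) sums (z * \<psi> k + z ^ 0 * cmv \<alpha> (u 0) k)"
    proof (rule sums_Suc)
      show "(\<lambda>m. z ^ Suc m * cmv \<alpha> (u (Suc m)) k) sums (z * \<psi> k)"
        using sums_mult[OF \<psi>[of k], of z] by (simp add: ES mult.assoc)
    qed
    ultimately have "cmv \<alpha> \<psi> k = z * \<psi> k + z ^ 0 * cmv \<alpha> (u 0) k" by (rule sums_unique2)
    then show ?thesis by (simp add: E0)
  qed
  moreover have "\<psi> \<in> ell2"
  proof -
    have sq: "(cmod (\<psi> k))\<^sup>2 \<le> C * (\<Sum>m. cmod z ^ m * (cmod (u m k))\<^sup>2)"
      and sqs: "summable (\<lambda>m. cmod z ^ m * (cmod (u m k))\<^sup>2)" for k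
    proof -
      have u2: "(cmod (u m k))\<^sup>2 \<le> 1" for m using ub[of m k] by (simp add: abs_square_le_1)
      show s2: "summable (\<lambda>m. cmod z ^ m * (cmod (u m k))\<^sup>2)"
        by (rule summable_comparison_test[OF _ sums_summable[OF geo]])
          (use u2 in \<open>auto intro!: exI[of _ 0] mult_left_le simp: abs_mult\<close>)
      define S where "S = (\<Sum>m. cmod z ^ m * cmod (u m k))"
      have "cmod (\<psi> k) \<le> S"
        unfolding \<psi>_def S_def using summable_norm[of "\<lambda>m. z ^ m * u m k"] sumabs[of k]
        by (simp add: norm_mult norm_power)
      then have "(cmod (\<psi> k))\<^sup>2 \<le> S\<^sup>2" by (intro power_mono) auto
      \<comment> \<open>Cauchy--Schwarz for the weights \<open>\<bar>z\<bar>\<^sup>m\<close>, as nonnegativity of the weighted variance\<close>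
      also have "S\<^sup>2 \<le> C * (\<Sum>m. cmod z ^ m * (cmod (u m k))\<^sup>2)"
      proof -
        define Q where "Q = (\<Sum>m. cmod z ^ m * (cmod (u m k))\<^sup>2)"
        define t where "t = S / C"
        have tC: "t * C = S" using C by (simp add: t_def)
        have Q: "(\<lambda>m. cmod z ^ m * (cmod (u m k))\<^sup>2) sums Q" unfolding Q_def by (rule summable_sums[OF s2])
        have S: "(\<lambda>m. cmod z ^ m * cmod (u m k)) sums S" unfolding S_def by (rule summable_sums[OF sumabs])
        have "(\<lambda>m. cmod z ^ m * (cmod (u m k))\<^sup>2 - 2 * t * (cmod z ^ m * cmod (u m k)) + t\<^sup>2 * cmod z ^ m) sums
           (Q - 2 * t * S + t\<^sup>2 * C)"
          by (rule sums_add[OF sums_diff[OF Q sums_mult[OF S]] sums_mult[OF geo]])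
        moreover have "cmod z ^ m * (cmod (u m k))\<^sup>2 - 2 * t * (cmod z ^ m * cmod (u m k)) + t\<^sup>2 * cmod z ^ m
            = cmod z ^ m * (cmod (u m k) - t)\<^sup>2" for m
          by (simp add: power2_diff algebra_simps)
        ultimately have sm: "(\<lambda>m. cmod z ^ m * (cmod (u m k) - t)\<^sup>2) sums (Q - 2 * t * S + t\<^sup>2 * C)"
          by (simp only:)
        have "0 \<le> Q - 2 * t * S + t\<^sup>2 * C"
          by (rule sums_le[OF _ sums_zero sm]) auto
        then have "0 \<le> C * (Q - 2 * t * S + t\<^sup>2 * C)" using C by simp
        also have "\<dots> = C * Q - 2 * (t * C) * S + (t * C) * (t * C)"
          by (simp add: algebra_simps power2_eq_square)
        also have "\<dots> = C * (\<Sum>m. cmod z ^ m * (cmod (u m k))\<^sup>2) - S\<^sup>2"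
          unfolding tC Q_def by (simp add: power2_eq_square)
        finally show ?thesis by simp
      qed
      finally show "(cmod (\<psi> k))\<^sup>2 \<le> C * (\<Sum>m. cmod z ^ m * (cmod (u m k))\<^sup>2)" .
    qed
    \<comment> \<open>Summing the weighted Cauchy-Schwarz bound over k and exchanging sums leaves
      the energies of the \<open>u m\<close>, all equal to 1, and hence the total
      \<open>C * C\<close>.\<close>
    have "ell2_energy \<psi> \<le> (\<integral>\<^sup>+k. ennreal C * (\<Sum>m. ennreal (cmod z ^ m) * ennreal ((cmod (u m k))\<^sup>2)) \<partial>count_space UNIV)"
      unfolding ell2_energy_def
    proof (rule nn_integral_mono)
      fix k
      have "ennreal ((cmod (\<psi> k))\<^sup>2) \<le> ennreal (C * (\<Sum>m. cmod z ^ m * (cmod (u m k))\<^sup>2))"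
        by (rule ennreal_leI[OF sq])
      also have "\<dots> = ennreal C * ennreal (\<Sum>m. cmod z ^ m * (cmod (u m k))\<^sup>2)"
        by (rule ennreal_mult) (use C in simp, rule suminf_nonneg[OF sqs], simp)
      also have "ennreal (\<Sum>m. cmod z ^ m * (cmod (u m k))\<^sup>2) = (\<Sum>m. ennreal (cmod z ^ m * (cmod (u m k))\<^sup>2))"
        by (rule suminf_ennreal2[symmetric]) (use sqs in auto)
      finally show "ennreal ((cmod (\<psi> k))\<^sup>2) \<le> ennreal C * (\<Sum>m. ennreal (cmod z ^ m) * ennreal ((cmod (u m k))\<^sup>2))"
        by (simp add: ennreal_mult)
    qed
    also have "\<dots> = ennreal C * (\<Sum>m. ennreal (cmod z ^ m) * ell2_energy (u m))"
    proof -
      have "(\<integral>\<^sup>+k. (\<Sum>m. ennreal (cmod z ^ m) * ennreal ((cmod (u m k))\<^sup>2)) \<partial>count_space UNIV)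
          = (\<Sum>m. \<integral>\<^sup>+k. ennreal (cmod z ^ m) * ennreal ((cmod (u m k))\<^sup>2) \<partial>count_space UNIV)"
        by (rule nn_integral_suminf) simp
      also have "\<dots> = (\<Sum>m. ennreal (cmod z ^ m) * ell2_energy (u m))"
        unfolding ell2_energy_def by (subst nn_integral_cmult) simp_all
      finally show ?thesis by (subst nn_integral_cmult) simp_all
    qed
    also have "\<dots> = ennreal C * ennreal C"
    proof -
      have "(\<Sum>m. ennreal (cmod z ^ m)) = ennreal (\<Sum>m. cmod z ^ m)"
        by (rule suminf_ennreal2[OF _ sums_summable[OF geo]]) simp
      then show ?thesis by (simp only: uN mult_1_right sums_unique[OF geo, symmetric])
    qed
    also have "\<dots> < \<infinity>" by (simp add: ennreal_mult_less_top)
    finally show ?thesis by (simp add: ell2_iff_energy)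
  qed
  ultimately show thesis using that by blast
qed

text \<open>The deviation \<open>y - g x\<close> satisfies a scalar recursion which, weighted by \<open>1 - \<bar>g\<bar>\<^sup>2\<close>,
  cannot decay unless it vanishes.\<close>

lemma schur_weyl_solution:
  fixes x y g s t \<gamma> :: "nat \<Rightarrow> complex"
  assumes z: "cmod z < 1" and \<gamma>: "\<And>i. cmod (\<gamma> i) \<le> 1"
    and y: "\<And>i. y i = \<gamma> i * x i + of_real (rho (\<gamma> i)) * (s i * y (Suc i))"
    and x: "\<And>i. x (Suc i) = t i * (of_real (rho (\<gamma> i)) * x i - cnj (\<gamma> i) * (s i * y (Suc i)))"
    and st: "\<And>i. s i * t i = z" and s: "\<And>i. cmod (s i) \<le> 1"
    and g: "\<And>i. g i = schur_step (\<gamma> i) (z * g (Suc i))" and g1: "\<And>i. cmod (g i) \<le> 1"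
    and lim: "x \<longlonglongrightarrow> 0" "y \<longlonglongrightarrow> 0"
  shows "y 0 = g 0 * x 0"
proof -
  define e where "e = (\<lambda>i. y i - g i * x i)"
  define D where "D = (\<lambda>i. 1 + cnj (\<gamma> i) * (z * g (Suc i)))"
  have zg: "cmod (z * g i) < 1" for i using z g1 by (intro cmod_mult_less_1)
  have D: "D i \<noteq> 0" for i unfolding D_def using \<gamma> zg by (intro schur_step_denom_nz)
  \<comment> \<open>Eliminating the next \<open>x\<close> and \<open>y\<close> uses only s t = z and
    rho^2 = 1 - |\<gamma>|^2. Nothing is divided by rho, so rho = 0 is covered and then gives e = 0
    at once.\<close>
  have eD: "e i * D i = of_real (rho (\<gamma> i)) * (s i * e (Suc i))" for i
  proof -
    let ?r = "complex_of_real (rho (\<gamma> i))"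
    have gD: "g i * D i = \<gamma> i + z * g (Suc i)" using D[of i] g[of i] by (simp add: schur_step_def D_def)
    have y': "y (Suc i) = e (Suc i) + g (Suc i) * x (Suc i)" by (simp add: e_def)
    have "x (Suc i) = t i * ?r * x i - cnj (\<gamma> i) * (s i * t i) * (e (Suc i) + g (Suc i) * x (Suc i))"
      using x[of i] unfolding y' by (simp add: algebra_simps)
    then have xD: "x (Suc i) * D i = t i * ?r * x i - cnj (\<gamma> i) * z * e (Suc i)"
      unfolding st by (simp add: D_def algebra_simps)
    have "y i * D i = \<gamma> i * x i * D i + ?r * (s i * e (Suc i)) * D i + ?r * s i * g (Suc i) * (x (Suc i) * D i)"
      using y[of i] unfolding y' by (simp add: algebra_simps)
    also have "\<dots> = \<gamma> i * x i * D i + ?r * (s i * e (Suc i)) * D i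
        + (?r * ?r) * (s i * t i) * g (Suc i) * x i - ?r * s i * g (Suc i) * cnj (\<gamma> i) * z * e (Suc i)"
      unfolding xD by (simp add: algebra_simps)
    also have "\<dots> = (\<gamma> i + z * g (Suc i)) * x i + ?r * (s i * e (Suc i))"
      unfolding st rho_sq[OF \<gamma>] by (simp add: D_def algebra_simps)
    finally have yD: "y i * D i = (\<gamma> i + z * g (Suc i)) * x i + ?r * (s i * e (Suc i))" .
    have "e i * D i = y i * D i - (g i * D i) * x i" by (simp add: e_def algebra_simps)
    then show ?thesis unfolding yD gD by simp
  qed
  define a where "a = (\<lambda>i. (cmod (e i))\<^sup>2)"
  define q where "q = (\<lambda>i. 1 - (cmod (g i))\<^sup>2)"
  \<comment> \<open>\<open>q\<close> is the defect of g and may be arbitrarily small or zero;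
    \<open>p\<close>, the defect of z g, is bounded below by 1 - |z|^2. The Moebius step turns
    \<open>p (Suc i)\<close> into \<open>q i\<close>.\<close>
  define p where "p = (\<lambda>i. 1 - (cmod (z * g i))\<^sup>2)"
  have a0: "0 \<le> a i" for i by (simp add: a_def)
  have p: "1 - (cmod z)\<^sup>2 \<le> p i" "q i \<le> p i" "0 < p i" "q i \<le> 1" "0 \<le> q i" for i
  proof -
    have "cmod z * cmod (g i) \<le> cmod z" "cmod z * cmod (g i) \<le> cmod (g i)"
      using z g1[of i] by (simp_all add: mult_left_le mult_left_le_one_le)
    then have "(cmod (z * g i))\<^sup>2 \<le> (cmod z)\<^sup>2" "(cmod (z * g i))\<^sup>2 \<le> (cmod (g i))\<^sup>2"
      by (auto intro!: power_mono simp: norm_mult)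
    moreover have "(cmod (z * g i))\<^sup>2 < 1" using zg[of i] by (simp add: abs_square_less_1)
    moreover have "(cmod (g i))\<^sup>2 \<le> 1" using g1[of i] by (simp add: abs_square_le_1)
    ultimately show "1 - (cmod z)\<^sup>2 \<le> p i" "q i \<le> p i" "0 < p i" "q i \<le> 1" "0 \<le> q i" by (auto simp: p_def q_def)
  qed
  \<comment> \<open>The cross-multiplied form of a_i / q_i \<le> a_(i+1) / p_(i+1), valid also when
    \<open>q i\<close> is zero.\<close>
  have step: "a i * p (Suc i) \<le> a (Suc i) * q i" for i
  proof -
    let ?d = "(cmod (D i))\<^sup>2"
    have d: "0 < ?d" using D[of i] by simp
    have qd: "q i * ?d = (rho (\<gamma> i))\<^sup>2 * p (Suc i)"
      using schur_step_defect_norm[OF \<gamma>[of i] zg[of "Suc i"]] d rho_power2[OF \<gamma>[of i]]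
      unfolding g[of i, symmetric] by (simp add: q_def p_def D_def)
    have "a i * ?d = (rho (\<gamma> i))\<^sup>2 * (cmod (s i))\<^sup>2 * a (Suc i)"
      using arg_cong[OF eD[of i], of "\<lambda>w. (cmod w)\<^sup>2"] by (simp add: a_def norm_mult power_mult_distrib)
    also have "\<dots> \<le> (rho (\<gamma> i))\<^sup>2 * 1 * a (Suc i)"
      using s[of i] a0 by (intro mult_right_mono mult_left_mono) (auto simp: abs_square_le_1)
    finally have "a i * ?d * p (Suc i) \<le> (rho (\<gamma> i))\<^sup>2 * 1 * a (Suc i) * p (Suc i)"
      using p by (intro mult_right_mono) (auto intro: less_imp_le)
    also have "\<dots> = a (Suc i) * q i * ?d" using qd by (simp add: mult_ac)
    finally have "(a i * p (Suc i)) * ?d \<le> (a (Suc i) * q i) * ?d" by (simp add: mult_ac)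
    then show ?thesis using d by (simp add: mult_le_cancel_right_pos)
  qed
  \<comment> \<open>Iterating \<open>step\<close> produces quotients q_i / p_i \<le> 1, which are
    dropped. Only the last \<open>p\<close> survives, and its lower bound turns decay of
    \<open>a\<close> into \<open>a 0 = 0\<close>.\<close>
  have bound: "a 0 * p (Suc J) \<le> a (Suc J)" for J
  proof (induction J)
    case 0
    have "a 0 * p (Suc 0) \<le> a (Suc 0) * q 0" by (rule step)
    also have "\<dots> \<le> a (Suc 0) * 1" using p a0 by (intro mult_left_mono) auto
    finally show ?case by simp
  next
    case (Suc J)
    have "a 0 * p (Suc J) * p (Suc (Suc J)) \<le> a (Suc J) * p (Suc (Suc J))"
      using Suc p by (intro mult_right_mono) (auto intro: less_imp_le)
    also have "\<dots> \<le> a (Suc (Suc J)) * q (Suc J)" by (rule step)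
    also have "\<dots> \<le> a (Suc (Suc J)) * p (Suc J)" using p a0 by (intro mult_left_mono) auto
    finally have "(a 0 * p (Suc (Suc J))) * p (Suc J) \<le> a (Suc (Suc J)) * p (Suc J)" by (simp add: mult_ac)
    then show ?case using p(3)[of "Suc J"] by (simp add: mult_le_cancel_right_pos)
  qed
  have "(\<lambda>i. cmod (x i)) \<longlonglongrightarrow> 0" using lim(1) by (rule tendsto_norm_zero)
  then have "(\<lambda>i. g i * x i) \<longlonglongrightarrow> 0"
    by (rule Lim_null_comparison[rotated])
      (use g1 in \<open>auto simp: norm_mult intro!: always_eventually mult_left_le_one_le\<close>)
  then have "e \<longlonglongrightarrow> 0 - 0" unfolding e_def by (intro tendsto_diff lim)
  then have "a \<longlonglongrightarrow> (cmod 0)\<^sup>2" unfolding a_def by (intro tendsto_power tendsto_norm) simp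
  then have "(\<lambda>J. a (Suc J)) \<longlonglongrightarrow> 0" by (simp add: LIMSEQ_Suc)
  then have "a 0 * (1 - (cmod z)\<^sup>2) \<le> 0"
  proof (rule LIMSEQ_le_const)
    have "a 0 * (1 - (cmod z)\<^sup>2) \<le> a (Suc J)" for J
      using bound[of J] mult_left_mono[OF p(1)[of "Suc J"] a0[of 0]] by linarith
    then show "\<exists>N. \<forall>n\<ge>N. a 0 * (1 - (cmod z)\<^sup>2) \<le> a (Suc n)" by blast
  qed
  moreover have "0 < 1 - (cmod z)\<^sup>2" using z by (simp add: abs_square_less_1)
  ultimately have "a 0 = 0" using a0[of 0] by (simp add: mult_le_0_iff)
  then show ?thesis by (simp add: a_def e_def)
qed

section \<open>Diagonal resolvent entries and the Caratheodory functions\<close>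

lemma f_plus_rec:
  assumes "\<And>k. cmod (\<alpha> k) \<le> 1" "cmod z < 1"
  shows "f_plus \<alpha> n z = schur_step (\<alpha> n) (z * f_plus \<alpha> (n + 1) z)"
  unfolding f_plus_def using assms by (subst schur_fun_rec) (simp_all add: add_ac)

lemma f_minus_rec:
  assumes "\<And>k. cmod (\<alpha> k) \<le> 1" "cmod z < 1"
  shows "f_minus \<alpha> (n + 1) z = schur_step (- cnj (\<alpha> n)) (z * f_minus \<alpha> n z)"
  unfolding f_minus_def using assms by (subst schur_fun_rec) (simp_all add: algebra_simps)

lemma f_plus_norm_le:
  assumes "\<And>k. cmod (\<alpha> k) \<le> 1" "cmod z < 1"
  shows "cmod (f_plus \<alpha> n z) \<le> 1"
  unfolding f_plus_def using assms by (intro schur_fun_norm_le) auto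

lemma f_minus_norm_le:
  assumes "\<And>k. cmod (\<alpha> k) \<le> 1" "cmod z < 1"
  shows "cmod (f_minus \<alpha> n z) \<le> 1"
  unfolding f_minus_def using assms by (intro schur_fun_norm_le) auto

text \<open>At site n one half-line gives the ratio of \<psi> to \<phi> = M \<psi> and the other the
  ratio of \<phi> to E \<psi>, in an order depending on parity; multiplying them eliminates \<phi>.
  The constant c is left free: 1 yields the resolvent entry and 0 yields injectivity of E -
  z.\<close>

lemma cmv_solution_diagonal:
  assumes a: "\<And>k. cmod (\<alpha> k) \<le> 1" and z: "cmod z < 1" and \<psi>: "\<psi> \<in> ell2"
    and eq: "\<And>k. cmv \<alpha> \<psi> k - z * \<psi> k = c * delta n k"
  shows "\<psi> n = f_plus \<alpha> n z * f_minus \<alpha> n z * (z * \<psi> n + c)"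
proof -
  define \<phi> where "\<phi> = cmv_M \<alpha> \<psi>"
  define D where "D = cmv_L \<alpha> \<phi>"
  have Deq: "D k = z * \<psi> k + c * delta n k" for k
    using eq[of k] by (simp add: D_def \<phi>_def cmv_def algebra_simps)
  have Dn: "D n = z * \<psi> n + c" by (simp add: Deq delta_def)
  have Dk: "D k = z * \<psi> k" if "k \<noteq> n" for k using that by (simp add: Deq delta_def)
  have ell: "\<phi> \<in> ell2" "D \<in> ell2"
    using \<psi> by (simp_all add: D_def \<phi>_def ell2_iff_energy ell2_energy_cmv_L ell2_energy_cmv_M a)
  have \<psi>M: "\<psi> = cmv_M (\<lambda>k. cnj (\<alpha> k)) \<phi>" and \<phi>L: "\<phi> = cmv_L (\<lambda>k. cnj (\<alpha> k)) D"
    using cmv_M_inverse[of "\<lambda>k. cnj (\<alpha> k)" \<psi>] cmv_L_inverse[of "\<lambda>k. cnj (\<alpha> k)" \<phi>] a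
    by (simp_all add: D_def \<phi>_def)
  have odd1: "\<psi> j = \<alpha> j * \<phi> j + of_real (rho (\<alpha> j)) * \<phi> (j + 1)"
    and odd2: "\<psi> (j + 1) = of_real (rho (\<alpha> j)) * \<phi> j - cnj (\<alpha> j) * \<phi> (j + 1)" if "odd j" for j
    using cmv_M_odd[OF that, of "\<lambda>k. cnj (\<alpha> k)" \<phi>] by (simp_all flip: \<psi>M)
  have even1: "\<phi> j = \<alpha> j * D j + of_real (rho (\<alpha> j)) * D (j + 1)"
    and even2: "\<phi> (j + 1) = of_real (rho (\<alpha> j)) * D j - cnj (\<alpha> j) * D (j + 1)" if "even j" for j
    using cmv_L_even[OF that, of "\<lambda>k. cnj (\<alpha> k)" D] by (simp_all flip: \<phi>L)
  \<comment> \<open>Block j ties \<open>D\<close> to \<open>\<phi>\<close> for even j and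
    \<open>\<phi>\<close> to \<open>\<psi>\<close> for odd j. \<open>P\<close> and \<open>Q\<close>
    are the two sequences tied by the block to the right of a site, \<open>P'\<close> and
    \<open>Q'\<close> those tied by the block to its left, so that one recursion serves both
    parities.\<close>
  define P where "P = (\<lambda>j. if even j then D j else \<phi> j)"
  define Q where "Q = (\<lambda>j. if even j then \<phi> j else \<psi> j)"
  define P' where "P' = (\<lambda>j. if even j then \<phi> j else D j)"
  define Q' where "Q' = (\<lambda>j. if even j then \<psi> j else \<phi> j)"
  have lim: "(\<lambda>i. (if even (h i) then u (h i) else v (h i))) \<longlonglongrightarrow> 0"
    if "u \<in> ell2" "v \<in> ell2" "inj h" for u v and h :: "nat \<Rightarrow> int"
  proof (rule Lim_null_comparison)
    show "\<forall>\<^sub>F i in sequentially. norm (if even (h i) then u (h i) else v (h i)) \<le> cmod (u (h i)) + cmod (v (h i))"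
      by (intro always_eventually) simp
    show "(\<lambda>i. cmod (u (h i)) + cmod (v (h i))) \<longlonglongrightarrow> 0"
      by (intro tendsto_add_zero tendsto_norm_zero ell2_tendsto_0 that)
  qed
  have inj: "inj (\<lambda>i. n + int i)" "inj (\<lambda>i. n - int i)" by (auto intro!: injI)
  \<comment> \<open>Only sites above n are visited when \<open>D\<close> is replaced by z
    \<open>\<psi>\<close>, so the source at n never enters. The resulting z falls on
    \<open>y\<close> at even sites and on \<open>x\<close> at odd ones; \<open>s\<close> and
    \<open>t\<close> record this.\<close>
  have right: "Q (n + int 0) = f_plus \<alpha> (n + int 0) z * P (n + int 0)"
  proof (rule schur_weyl_solution[where \<gamma> = "\<lambda>i. \<alpha> (n + int i)"
        and s = "\<lambda>i. if even (n + int i) then z else 1" and t = "\<lambda>i. if even (n + int i) then 1 else z"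
        and x = "\<lambda>i. P (n + int i)" and y = "\<lambda>i. Q (n + int i)" and g = "\<lambda>i. f_plus \<alpha> (n + int i) z", OF z])
    fix i
    define j where "j = n + int i"
    have j1: "n + int (Suc i) = j + 1" "j + 1 \<noteq> n" by (simp_all add: j_def)
    show "Q (n + int i) = \<alpha> (n + int i) * P (n + int i) + of_real (rho (\<alpha> (n + int i)))
        * ((if even (n + int i) then z else 1) * Q (n + int (Suc i)))"
      unfolding j1 j_def[symmetric] using odd1[of j] even1[of j] Dk[OF j1(2)] by (simp add: P_def Q_def)
    show "P (n + int (Suc i)) = (if even (n + int i) then 1 else z)
        * (of_real (rho (\<alpha> (n + int i))) * P (n + int i) - cnj (\<alpha> (n + int i)) * ((if even (n + int i) then z else 1) * Q (n + int (Suc i))))"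
      unfolding j1 j_def[symmetric] using odd2[of j] even2[of j] Dk[OF j1(2)] by (simp add: P_def Q_def)
    show "f_plus \<alpha> (n + int i) z = schur_step (\<alpha> (n + int i)) (z * f_plus \<alpha> (n + int (Suc i)) z)"
      using f_plus_rec[of \<alpha> z "n + int i"] a z by (simp add: add_ac)
  qed (use a z f_plus_norm_le[of \<alpha> z] lim[OF ell(2,1) inj(1)] lim[OF ell(1) \<psi> inj(1)] in \<open>auto simp: P_def Q_def\<close>)
  have left: "Q' (n - int 0) = f_minus \<alpha> (n - int 0) z * P' (n - int 0)"
  proof (rule schur_weyl_solution[where \<gamma> = "\<lambda>i. - cnj (\<alpha> (n - int (Suc i)))"
        and s = "\<lambda>i. if even (n - int i) then 1 else z" and t = "\<lambda>i. if even (n - int i) then z else 1"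
        and x = "\<lambda>i. P' (n - int i)" and y = "\<lambda>i. Q' (n - int i)" and g = "\<lambda>i. f_minus \<alpha> (n - int i) z", OF z])
    fix i
    define j where "j = n - int (Suc i)"
    have j1: "n - int i = j + 1" "j \<noteq> n" by (simp_all add: j_def)
    show "Q' (n - int i) = - cnj (\<alpha> (n - int (Suc i))) * P' (n - int i) + of_real (rho (- cnj (\<alpha> (n - int (Suc i)))))
        * ((if even (n - int i) then 1 else z) * Q' (n - int (Suc i)))"
      unfolding j1 j_def[symmetric] using odd2[of j] even2[of j] Dk[OF j1(2)] by (simp add: P'_def Q'_def)
    show "P' (n - int (Suc i)) = (if even (n - int i) then z else 1)
        * (of_real (rho (- cnj (\<alpha> (n - int (Suc i))))) * P' (n - int i)
          - cnj (- cnj (\<alpha> (n - int (Suc i)))) * ((if even (n - int i) then 1 else z) * Q' (n - int (Suc i))))"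
      unfolding j1 j_def[symmetric] using odd1[of j] even1[of j] Dk[OF j1(2)] by (simp add: P'_def Q'_def)
    show "f_minus \<alpha> (n - int i) z = schur_step (- cnj (\<alpha> (n - int (Suc i)))) (z * f_minus \<alpha> (n - int (Suc i)) z)"
      using f_minus_rec[of \<alpha> z j] a z unfolding j1 j_def[symmetric] by simp
  qed (use a z f_minus_norm_le[of \<alpha> z] lim[OF ell(1,2) inj(2)] lim[OF \<psi> ell(1) inj(2)] in \<open>auto simp: P'_def Q'_def\<close>)
  show ?thesis
    using left right Dn by (cases "even n") (auto simp: P_def Q_def P'_def Q'_def mult_ac)
qed

lemma caratheodory_spectral_measure:
  assumes a: "\<And>k. cmod (\<alpha> k) \<le> 1" and z: "cmod z < 1" and \<nu>: "is_spectral_measure \<alpha> n \<nu>"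
  shows "caratheodory \<nu> z = (1 + z * f_plus \<alpha> n z * f_minus \<alpha> n z) / (1 - z * f_plus \<alpha> n z * f_minus \<alpha> n z)"
proof -
  obtain \<psi> where \<psi>: "\<psi> \<in> ell2" and eq: "\<And>k. cmv \<alpha> \<psi> k - z * \<psi> k = delta n k"
    using cmv_resolvent_exists[of \<alpha> z n] a z by blast
  have nz: "1 - z * (f_plus \<alpha> m z * f_minus \<alpha> m z) \<noteq> 0" for m
  proof -
    have "cmod (f_plus \<alpha> m z * f_minus \<alpha> m z) \<le> 1"
      using f_plus_norm_le[of \<alpha> z m] f_minus_norm_le[of \<alpha> z m] a z by (simp add: norm_mult mult_le_one)
    from cmod_mult_less_1[OF z this] show ?thesis by auto
  qed
  \<comment> \<open>The diagonal identity for the homogeneous equation, applied at every site: the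
    coefficient 1 - z f_+ f_- is nonzero in the disc, so the solution vanishes entry by
    entry.\<close>
  have inj: "inj_on (\<lambda>u k. cmv \<alpha> u k - z * u k) ell2"
  proof (rule inj_onI)
    fix u v assume u: "u \<in> ell2" "v \<in> ell2" and e: "(\<lambda>k. cmv \<alpha> u k - z * u k) = (\<lambda>k. cmv \<alpha> v k - z * v k)"
    define w where "w = (\<lambda>k. u k - v k)"
    have w: "cmv \<alpha> w k - z * w k = 0 * delta m k" for k m
      using fun_cong[OF e, of k] by (simp add: w_def cmv_diff algebra_simps)
    have "w m = f_plus \<alpha> m z * f_minus \<alpha> m z * (z * w m + 0)" for m
      by (rule cmv_solution_diagonal[OF a z _ w]) (simp add: w_def ell2_diff u)
    then have "w m * (1 - z * (f_plus \<alpha> m z * f_minus \<alpha> m z)) = 0" for m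
      by (metis add.right_neutral diff_self mult.assoc mult.commute mult.right_neutral right_diff_distrib)
    then have "w m = 0" for m using nz[of m] by (metis mult_eq_0_iff)
    then show "u = v" by (auto simp: w_def)
  qed
  have res: "cmv_resolvent \<alpha> z (delta n) = \<psi>"
    unfolding cmv_resolvent_def using the_inv_into_f_f[OF inj \<psi>] eq by simp
  have inner: "ell2_inner (delta n) v = v n" for v
  proof -
    have "(\<Sum>\<^sub>\<infinity>k. cnj (delta n k) * v k) = (\<Sum>\<^sub>\<infinity>k\<in>{n}. cnj (delta n k) * v k)"
      by (rule infsum_cong_neutral) (auto simp: delta_def)
    then show ?thesis by (simp add: ell2_inner_def delta_def)
  qed
  let ?f = "f_plus \<alpha> n z * f_minus \<alpha> n z"
  have "\<psi> n = ?f * (z * \<psi> n + 1)"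
    by (rule cmv_solution_diagonal[OF a z \<psi>]) (simp add: eq)
  then have "\<psi> n * (1 - z * ?f) = ?f" by (simp add: algebra_simps)
  then have pn: "\<psi> n = ?f / (1 - z * ?f)" using nz[of n] by (simp add: eq_divide_eq)
  have "caratheodory \<nu> z = cmv \<alpha> \<psi> n + z * \<psi> n"
    using \<nu> z by (simp add: is_spectral_measure_def res inner)
  also have "\<dots> = 1 + 2 * z * \<psi> n" using eq[of n] by (simp add: delta_def algebra_simps)
  also have "\<dots> = (1 + z * ?f) / (1 - z * ?f)" unfolding pn using nz[of n] by (simp add: field_simps)
  finally show ?thesis by (simp add: mult.assoc)
qed

section \<open>A boundary uniqueness theorem\<close>

text \<open>The offset s may vary with N in an uncontrolled way. Periodicity makes the integral over
  [s, s + 2 pi] independent of s, and uniform continuity bounds the Riemann error uniformly in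
  s.\<close>

lemma periodic_riemann_sum_le:
  fixes u :: "real \<Rightarrow> real" and c :: real
  assumes cont: "continuous_on UNIV u" and per: "\<And>t. u (t + 2 * pi) = u t"
    and sums: "\<And>N. 0 < N \<Longrightarrow> \<exists>s\<in>{0..2*pi}. real N * c \<le> (\<Sum>j<N. u (s + 2 * pi * real j / real N))"
  shows "2 * pi * c \<le> integral {0..2*pi} u"
proof -
  \<comment> \<open>Starting at -1 makes the primitive differentiable at 0 from both sides. The grid
    points reach s + 2 pi, at most 4 pi.\<close>
  define U where "U = (\<lambda>x. integral {-1..x} u)"
  have dU: "(U has_real_derivative u t) (at t)" if "0 \<le> t" "t \<le> 4 * pi" for t
  proof -
    have "(U has_real_derivative u t) (at t within {-1..4*pi+1})"
      unfolding U_def using that by (intro integral_has_real_derivative continuous_on_subset[OF cont]) auto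
    moreover have "at t within {-1..4*pi+1} = at t" using that by (intro at_within_interior) auto
    ultimately show ?thesis by simp
  qed
  have shift: "U (s + 2 * pi) - U s = U (2 * pi) - U 0" if s: "s \<in> {0..2*pi}" for s
  proof (cases "s = 0")
    case False
    have d: "((\<lambda>s. U (s + 2 * pi) - U s) has_real_derivative 0) (at x)" if "0 \<le> x" "x \<le> s" for x
    proof -
      have "((\<lambda>s. U (s + 2 * pi)) has_real_derivative u (x + 2 * pi)) (at x)"
        using dU[of "x + 2 * pi"] that s by (simp add: DERIV_shift add.commute)
      from DERIV_diff[OF this dU[of x]] show ?thesis using that s per[of x] by simp
    qed
    have "(\<lambda>s. U (s + 2 * pi) - U s) s = (\<lambda>s. U (s + 2 * pi) - U s) 0"
      by (rule DERIV_isconst_end) (use False s d in \<open>auto intro!: continuous_at_imp_continuous_on DERIV_isCont\<close>)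
    then show ?thesis by simp
  qed simp
  have int: "integral {0..2*pi} u = U (2 * pi) - U 0"
  proof (rule integral_unique, rule fundamental_theorem_of_calculus)
    fix x assume "x \<in> {0..2*pi}"
    then have "(U has_real_derivative u x) (at x)" by (intro dU) auto
    then show "(U has_vector_derivative u x) (at x within {0..2*pi})"
      by (simp add: has_real_derivative_iff_has_vector_derivative has_vector_derivative_at_within)
  qed auto
  have approx: "2 * pi * c \<le> integral {0..2*pi} u + 2 * pi * e" if e: "0 < e" for e
  proof -
    have "uniformly_continuous_on {0..4*pi} u"
      by (intro compact_uniformly_continuous continuous_on_subset[OF cont]) auto
    then obtain d where d: "0 < d" "\<And>x y. x \<in> {0..4*pi} \<Longrightarrow> y \<in> {0..4*pi} \<Longrightarrow> dist x y < d \<Longrightarrow> dist (u x) (u y) < e"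
      using e unfolding uniformly_continuous_on_def by metis
    obtain N :: nat where "2 * pi / d < real N" using reals_Archimedean2 by blast
    then have N0: "2 * pi < d * real N" using d(1) by (simp add: divide_less_eq mult.commute)
    then have "0 < N" using pi_gt_zero by (cases "N = 0") auto
    then have N: "2 * pi / real N < d" "0 < N" using N0 by (auto simp: divide_less_eq)
    obtain s where s: "s \<in> {0..2*pi}" and le: "real N * c \<le> (\<Sum>j<N. u (s + 2 * pi * real j / real N))"
      using sums[OF N(2)] by blast
    define h where "h = 2 * pi / real N"
    have h: "0 < h" "real N * h = 2 * pi" using N by (auto simp: h_def)
    define p where "p = (\<lambda>j. s + real j * h)"
    have step: "h * (u (p j) - e) \<le> U (p (Suc j)) - U (p j)" if j: "j < N" for j
    proof -
      have "real (Suc j) * h \<le> real N * h" using j h(1) by (intro mult_right_mono) auto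
      then have b: "0 \<le> p j" "p (Suc j) \<le> 4 * pi" "p (Suc j) = p j + h"
        using s h by (auto simp: p_def algebra_simps)
      obtain x where x: "p j < x" "x < p (Suc j)" "U (p (Suc j)) - U (p j) = (p (Suc j) - p j) * u x"
        using MVT2[of "p j" "p (Suc j)" U u] dU b h by fastforce
      have "dist (u x) (u (p j)) < e"
        using x b h N by (intro d(2)) (auto simp: dist_real_def h_def)
      then have "h * (u (p j) - e) \<le> h * u x" using h by (intro mult_left_mono) (auto simp: dist_real_def)
      then show ?thesis using x b by simp
    qed
    have "h * (real N * c) \<le> h * (\<Sum>j<N. u (p j))"
      using le h(1) by (intro mult_left_mono) (auto simp: p_def h_def mult_ac)
    also have "\<dots> = (\<Sum>j<N. h * (u (p j) - e)) + 2 * pi * e"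
      unfolding h(2)[symmetric] by (simp add: sum_distrib_left[symmetric] sum_subtractf right_diff_distrib)
    also have "\<dots> \<le> (\<Sum>j<N. U (p (Suc j)) - U (p j)) + 2 * pi * e"
      using step by (intro add_right_mono sum_mono) auto
    also have "(\<Sum>j<N. U (p (Suc j)) - U (p j)) = U (p N) - U (p 0)" by (rule sum_lessThan_telescope)
    also have "\<dots> = integral {0..2*pi} u" using shift[OF s] int h by (simp add: p_def)
    finally have "h * (real N * c) \<le> integral {0..2*pi} u + 2 * pi * e" .
    moreover have "h * (real N * c) = 2 * pi * c"
      unfolding h(2)[symmetric] by (simp only: mult_ac)
    ultimately show ?thesis by simp
  qed
  show ?thesis
  proof (rule field_le_epsilon)
    fix e :: real assume "0 < e"
    then show "2 * pi * c \<le> integral {0..2*pi} u + e" using approx[of "e / (2 * pi)"] by simp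
  qed
qed

text \<open>Jensen's inequality for a truncated logarithm. The maximum principle for the product of the
  rotations of \<open>f\<close> by the \<open>N\<close>-th roots of unity gives it for Riemann sums.\<close>

lemma jensen_truncated:
  assumes hol: "f holomorphic_on ball 0 1" and f0: "f 0 \<noteq> 0" and r: "0 < r" "r < 1" and eps: "0 < e"
  shows "2 * pi * ln (cmod (f 0)) \<le> integral {0..2*pi} (\<lambda>t. ln (max (cmod (f (of_real r * cis t))) e))"
proof (rule periodic_riemann_sum_le)
  have "cmod (of_real r * cis t) < 1" for t using r by (simp add: norm_mult)
  then have "continuous_on UNIV (\<lambda>t. f (of_real r * cis t))"
    by (intro continuous_on_compose2[OF holomorphic_on_imp_continuous_on[OF hol]] continuous_intros) auto
  moreover have "max (cmod (f (of_real r * cis t))) e \<noteq> 0" for t using eps by linarith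
  ultimately show "continuous_on UNIV (\<lambda>t. ln (max (cmod (f (of_real r * cis t))) e))"
    by (intro continuous_intros) auto
  show "ln (max (cmod (f (of_real r * cis (t + 2 * pi)))) e) = ln (max (cmod (f (of_real r * cis t))) e)" for t
    by (simp flip: cis_mult)
next
  fix N :: nat assume N: "0 < N"
  define H where "H = (\<lambda>z. \<Prod>j<N. f (cis (2 * pi * real j / real N) * z))"
  have "(\<lambda>z. f (cis (2 * pi * real j / real N) * z)) holomorphic_on ball 0 1" for j
    by (rule holomorphic_on_compose_gen[OF _ hol, unfolded o_def]) (auto intro!: holomorphic_intros simp: norm_mult)
  then have holH: "H holomorphic_on ball 0 1" unfolding H_def by (intro holomorphic_intros) auto
  have sub: "cball 0 r \<subseteq> ball (0::complex) 1" using r by auto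
  have contH: "continuous_on (cball 0 r) H"
    by (rule continuous_on_subset[OF holomorphic_on_imp_continuous_on[OF holH] sub])
  have ne: "sphere (0::complex) r \<noteq> {}" using r by simp
  have "continuous_on (sphere 0 r) (\<lambda>z. cmod (H z))"
    by (intro continuous_intros continuous_on_subset[OF contH]) auto
  then obtain z where z: "z \<in> sphere 0 r" and max: "\<And>y. y \<in> sphere 0 r \<Longrightarrow> cmod (H y) \<le> cmod (H z)"
    using continuous_attains_sup[OF compact_sphere ne] by metis
  have "cmod (H 0) \<le> cmod (H z)"
  proof (rule maximum_modulus_frontier[where f = H and S = "cball 0 r" and B = "cmod (H z)"])
    show "H holomorphic_on interior (cball 0 r)"
      using sub by (intro holomorphic_on_subset[OF holH]) auto
    show "continuous_on (closure (cball 0 r)) H" using contH by simp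
    show "cmod (H y) \<le> cmod (H z)" if "y \<in> frontier (cball 0 r)" for y
      by (rule max) (use that r in simp)
  qed (use r in auto)
  then have le: "cmod (f 0) ^ N \<le> (\<Prod>j<N. cmod (f (cis (2 * pi * real j / real N) * z)))"
    by (simp add: H_def prod_norm norm_power)
  \<comment> \<open>The offset of the Riemann sum is the argument of a point where |H| is maximal on
    the circle of radius r, and |H 0| = |f 0|^N bounds that maximum from below.\<close>
  define s where "s = Arg2pi z"
  have s: "s \<in> {0..2*pi}" using Arg2pi_ge_0[of z] Arg2pi_lt_2pi[of z] by (auto simp: s_def)
  have zs: "z = of_real r * cis s"
    using z Arg2pi_eq[of z] by (simp add: s_def cis_conv_exp)
  define v where "v = (\<lambda>t. max (cmod (f (of_real r * cis t))) e)"
  have vpos: "0 < v t" for t using eps by (simp add: v_def less_max_iff_disj)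
  have "cmod (f (cis (2 * pi * real j / real N) * z)) \<le> v (s + 2 * pi * real j / real N)" for j
    by (simp add: v_def zs mult_ac flip: cis_mult)
  then have "(\<Prod>j<N. cmod (f (cis (2 * pi * real j / real N) * z))) \<le> (\<Prod>j<N. v (s + 2 * pi * real j / real N))"
    by (intro prod_mono) auto
  with le have "cmod (f 0) ^ N \<le> (\<Prod>j<N. v (s + 2 * pi * real j / real N))" by linarith
  then have "ln (cmod (f 0) ^ N) \<le> ln (\<Prod>j<N. v (s + 2 * pi * real j / real N))"
    using f0 vpos by (subst ln_le_cancel_iff) (auto intro: prod_pos)
  also have "\<dots> = (\<Sum>j<N. ln (v (s + 2 * pi * real j / real N)))"
    by (rule ln_prod) (simp, metis vpos less_irrefl)
  finally have "real N * ln (cmod (f 0)) \<le> (\<Sum>j<N. ln (v (s + 2 * pi * real j / real N)))"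
    using f0 by (simp add: ln_realpow)
  then show "\<exists>s\<in>{0..2*pi}. real N * ln (cmod (f 0)) \<le> (\<Sum>j<N. ln (max (cmod (f (of_real r * cis (s + 2 * pi * real j / real N)))) e))"
    using s by (auto simp: v_def)
qed

text \<open>Jensen bounds the integrals of -ln |f| over the circles uniformly by -2 pi ln |f 0|. By
  Fatou's lemma the lower limit along the radii \<open>r k\<close> is finite almost everywhere,
  whereas a radial limit 0 would make it infinite. The truncation level \<open>e k\<close> tends to
  0 so that it does not hide this divergence.\<close>

lemma ae_radial_limit_nonzero_schur:
  assumes hol: "f holomorphic_on ball 0 1" and bd: "\<And>z. z \<in> ball 0 1 \<Longrightarrow> cmod (f z) \<le> 1" and f0: "f 0 \<noteq> 0"
  shows "AE t in lebesgue_on {0..2*pi}. \<not> has_radial_limit f (cis t) 0"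
proof -
  define r where "r = (\<lambda>k::nat. 1 - 1 / (real k + 2))"
  define e where "e = (\<lambda>k::nat. 1 / (real k + 2))"
  have r: "0 < r k" "r k < 1" and e: "0 < e k" "e k \<le> 1" for k by (auto simp: r_def e_def field_simps)
  have elim: "e \<longlonglongrightarrow> 0" unfolding e_def
    using LIMSEQ_ignore_initial_segment[OF lim_1_over_n, of 2] by (simp add: add.commute)
  have rlim: "filterlim r (at_left 1) sequentially"
  proof -
    have "r \<longlonglongrightarrow> 1" using tendsto_diff[OF tendsto_const elim, of 1] by (simp add: r_def e_def)
    moreover have "r k \<noteq> 1" for k using r(2)[of k] by simp
    ultimately show ?thesis using r by (auto simp: filterlim_at intro!: always_eventually)
  qed
  define u where "u = (\<lambda>k t. - ln (max (cmod (f (of_real (r k) * cis t))) (e k)))"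
  have inb: "cmod (of_real (r k) * cis t) < 1" for k t using r[of k] by (simp add: norm_mult)
  have mpos: "0 < max (cmod (f (of_real (r k) * cis t))) (e k)" for k t using e[of k] by (simp add: less_max_iff_disj)
  have u0: "0 \<le> u k t" for k t
    using mpos[of k t] bd[of "of_real (r k) * cis t"] inb[of k t] e[of k] by (simp add: u_def)
  have cont: "continuous_on {0..2*pi} (u k)" for k
  proof -
    have "continuous_on {0..2*pi} (\<lambda>t. f (of_real (r k) * cis t))"
      using inb by (intro continuous_on_compose2[OF holomorphic_on_imp_continuous_on[OF hol]] continuous_intros) auto
    then show ?thesis unfolding u_def using mpos[of k, THEN less_imp_neq] by (intro continuous_intros) auto
  qed
  have int: "integrable (lebesgue_on {0..2*pi}) (u k)" for k by (rule continuous_imp_integrable_real[OF cont])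
  let ?C = "ennreal (- 2 * pi * ln (cmod (f 0)))"
  have bound: "(\<integral>\<^sup>+t. ennreal (u k t) \<partial>lebesgue_on {0..2*pi}) \<le> ?C" for k
  proof -
    have "(\<integral>\<^sup>+t. ennreal (u k t) \<partial>lebesgue_on {0..2*pi}) = ennreal (integral\<^sup>L (lebesgue_on {0..2*pi}) (u k))"
      by (rule nn_integral_eq_integral[OF int]) (use u0 in auto)
    also have "integral\<^sup>L (lebesgue_on {0..2*pi}) (u k) = integral {0..2*pi} (u k)"
      by (rule lebesgue_integral_eq_integral[OF int]) auto
    also have "\<dots> \<le> - 2 * pi * ln (cmod (f 0))"
      using jensen_truncated[OF hol f0 r e(1), of k k] by (simp add: u_def)
    finally show ?thesis by (simp add: ennreal_leI)
  qed
  have meas: "(\<lambda>t. ennreal (u k t)) \<in> borel_measurable (lebesgue_on {0..2*pi})" for k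
    using borel_measurable_integrable[OF int[of k]] by simp
  have "(\<integral>\<^sup>+t. liminf (\<lambda>k. ennreal (u k t)) \<partial>lebesgue_on {0..2*pi})
      \<le> liminf (\<lambda>k. \<integral>\<^sup>+t. ennreal (u k t) \<partial>lebesgue_on {0..2*pi})"
    by (rule nn_integral_liminf) (rule meas)
  also have "\<dots> \<le> liminf (\<lambda>k. ?C)" by (rule Liminf_mono) (use bound in auto)
  also have "\<dots> = ?C" by (simp add: Liminf_const)
  finally have "(\<integral>\<^sup>+t. liminf (\<lambda>k. ennreal (u k t)) \<partial>lebesgue_on {0..2*pi}) \<noteq> \<infinity>"
    by (auto simp: top_unique)
  then have "AE t in lebesgue_on {0..2*pi}. liminf (\<lambda>k. ennreal (u k t)) \<noteq> \<infinity>"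
    by (intro nn_integral_PInf_AE borel_measurable_liminf meas)
  then show ?thesis
  proof (rule AE_mp, intro AE_I2 impI notI)
    fix t assume fin: "liminf (\<lambda>k. ennreal (u k t)) \<noteq> \<infinity>" and lim: "has_radial_limit f (cis t) 0"
    have "(\<lambda>k. f (of_real (r k) * cis t)) \<longlonglongrightarrow> 0"
      using filterlim_compose[OF lim[unfolded has_radial_limit_def] rlim] by simp
    then have "(\<lambda>k. max (cmod (f (of_real (r k) * cis t))) (e k)) \<longlonglongrightarrow> max 0 0"
      by (intro tendsto_max elim tendsto_norm_zero)
    moreover have "\<forall>\<^sub>F k in sequentially. 0 < max (cmod (f (of_real (r k) * cis t))) (e k)"
      by (rule always_eventually) (use mpos in blast)
    ultimately have "filterlim (\<lambda>k. max (cmod (f (of_real (r k) * cis t))) (e k)) (at_right 0) sequentially"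
      by (intro tendsto_imp_filterlim_at_right) simp_all
    then have "filterlim (\<lambda>k. ln (max (cmod (f (of_real (r k) * cis t))) (e k))) at_bot sequentially"
      by (rule filterlim_compose[OF ln_at_0])
    then have "filterlim (\<lambda>k. u k t) at_top sequentially"
      by (simp add: u_def filterlim_uminus_at_bot)
    then have "((\<lambda>k. ennreal (u k t)) \<longlongrightarrow> \<infinity>) sequentially"
      by (simp add: ennreal_tendsto_top_eq_at_top)
    then have "liminf (\<lambda>k. ennreal (u k t)) = \<infinity>" by (intro lim_imp_Liminf) auto
    with fin show False by simp
  qed
qed

lemma ae_radial_limit_nonzero:
  assumes hol: "f holomorphic_on ball 0 1" and bd: "\<And>z. z \<in> ball 0 1 \<Longrightarrow> cmod (f z) \<le> B" and f0: "f 0 \<noteq> 0"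
  shows "AE t in lebesgue_on {0..2*pi}. \<not> has_radial_limit f (cis t) 0"
proof -
  have B: "0 < B" using bd[of 0] f0 by (smt (verit) centre_in_ball zero_less_norm_iff)
  have "AE t in lebesgue_on {0..2*pi}. \<not> has_radial_limit (\<lambda>z. f z / of_real B) (cis t) 0"
    using B bd f0 by (intro ae_radial_limit_nonzero_schur) (auto intro!: holomorphic_intros hol simp: norm_divide)
  then show ?thesis
  proof (rule AE_mp, intro AE_I2 impI notI)
    fix t assume n: "\<not> has_radial_limit (\<lambda>z. f z / of_real B) (cis t) 0" and "has_radial_limit f (cis t) 0"
    then have "has_radial_limit (\<lambda>z. f z / of_real B) (cis t) (0 / of_real B)"
      unfolding has_radial_limit_def using B by (intro tendsto_intros) auto
    with n show False by simp
  qed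
qed

section \<open>Radial boundary values\<close>

text \<open>Leaving out z = 0 costs nothing as r tends to 1, and admits identities that divide by
  z.\<close>

lemma eventually_radial:
  assumes "cmod w = 1" and "\<And>z. z \<noteq> 0 \<Longrightarrow> cmod z < 1 \<Longrightarrow> Q z"
  shows "\<forall>\<^sub>F r in at_left 1. Q (of_real r * w)"
proof -
  have "Q (of_real r * w)" if "0 < r" "r < 1" for r :: real
    using that assms by (intro assms(2)) (auto simp: norm_mult)
  then show ?thesis unfolding eventually_at_left[OF zero_less_one] by (intro exI[of _ 0]) auto
qed

lemma tendsto_radius: "((\<lambda>r::real. of_real r * w) \<longlongrightarrow> (w::complex)) (at_left 1)"
proof -
  have "((\<lambda>r::real. complex_of_real r * w) \<longlongrightarrow> of_real 1 * w) (at_left 1)" by (intro tendsto_intros)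
  then show ?thesis by simp
qed

lemma has_radial_limit_cong:
  assumes "has_radial_limit f w l" "cmod w = 1" "\<And>z. z \<noteq> 0 \<Longrightarrow> cmod z < 1 \<Longrightarrow> f z = g z"
  shows "has_radial_limit g w l"
  using assms(1) tendsto_cong[OF eventually_radial[of w "\<lambda>z. f z = g z", OF assms(2,3)]]
  by (simp add: has_radial_limit_def)

lemma has_radial_limit_unique:
  assumes "has_radial_limit f w a" "has_radial_limit f w b"
  shows "a = b"
  using assms tendsto_unique[OF trivial_limit_at_left_real] by (auto simp: has_radial_limit_def)

lemma has_radial_limit_norm_le:
  assumes "has_radial_limit f w a" "cmod w = 1" "\<And>z. cmod z < 1 \<Longrightarrow> cmod (f z) \<le> 1"
  shows "cmod a \<le> 1"
  by (rule tendsto_upperbound[OF tendsto_norm[OF assms(1)[unfolded has_radial_limit_def]]])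
    (use eventually_radial[of w "\<lambda>z. cmod (f z) \<le> 1"] assms in auto)

text \<open>Here the strict inequality is on the coefficient rather than on the argument, because
  boundary values may have modulus 1.\<close>

lemma schur_step_denom_nz_closed:
  assumes "cmod g < 1" "cmod v \<le> 1"
  shows "1 + cnj g * v \<noteq> 0"
  using schur_step_denom_nz[of "cnj v" "cnj g"] assms
  by (metis complex_cnj_add complex_cnj_cnj complex_cnj_mult complex_cnj_one complex_cnj_zero_iff
      complex_mod_cnj mult.commute)

lemma schur_step_minus:
  assumes "cmod g < 1" "cmod v \<le> 1"
  shows "schur_step (- g) (schur_step g v) = v"
proof -
  let ?d = "1 + cnj g * v"
  have d: "?d \<noteq> 0" by (rule schur_step_denom_nz_closed[OF assms])
  have g: "1 - cnj g * g \<noteq> 0" using schur_step_denom_nz_closed[of g "- g"] assms by simp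
  have "- g + schur_step g v = v * (1 - cnj g * g) / ?d" "1 + cnj (- g) * schur_step g v = (1 - cnj g * g) / ?d"
    using d by (simp_all add: schur_step_def field_simps)
  then show ?thesis unfolding schur_step_def[of "- g"] using d g by simp
qed

lemma cnj_schur_step: "cnj (schur_step g v) = schur_step (cnj g) (cnj v)"
  by (simp add: schur_step_def)

lemma has_radial_limit_schur_step:
  assumes "has_radial_limit h w b" "cmod w = 1" "cmod g < 1"
    and "\<And>z. cmod z < 1 \<Longrightarrow> cmod (h z) \<le> 1"
    and "\<And>z. cmod z < 1 \<Longrightarrow> f z = schur_step g (z * h z)"
  shows "has_radial_limit f w (schur_step g (w * b))"
proof -
  have "cmod b \<le> 1" using has_radial_limit_norm_le[OF assms(1,2,4)] .
  then have "1 + cnj g * (w * b) \<noteq> 0" using assms by (intro schur_step_denom_nz_closed) (auto simp: norm_mult)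
  then have "has_radial_limit (\<lambda>z. schur_step g (z * h z)) w (schur_step g (w * b))"
    using assms(1) unfolding has_radial_limit_def schur_step_def by (intro tendsto_intros tendsto_radius)
  then show ?thesis by (rule has_radial_limit_cong) (use assms in auto)
qed

lemma has_radial_limit_schur_step_inverse:
  assumes "has_radial_limit f w a" "cmod w = 1" "cmod g < 1"
    and h: "\<And>z. cmod z < 1 \<Longrightarrow> cmod (h z) \<le> 1"
    and f: "\<And>z. cmod z < 1 \<Longrightarrow> f z = schur_step g (z * h z)"
  shows "has_radial_limit h w (schur_step (- g) a / w)"
proof -
  have zh: "cmod (z * h z) < 1" if "cmod z < 1" for z using cmod_mult_less_1[OF that h[OF that]] .
  have "cmod (f z) \<le> 1" if "cmod z < 1" for z
    using f[OF that] zh[OF that] schur_step_norm_le[of g "z * h z"] assms(3) by simp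
  then have "cmod a \<le> 1" using has_radial_limit_norm_le[OF assms(1,2)] by blast
  then have "1 + cnj (- g) * a \<noteq> 0" using assms by (intro schur_step_denom_nz_closed) auto
  moreover have "w \<noteq> 0" using assms(2) by auto
  ultimately have "has_radial_limit (\<lambda>z. schur_step (- g) (f z) / z) w (schur_step (- g) a / w)"
    using assms(1) unfolding has_radial_limit_def schur_step_def by (intro tendsto_intros tendsto_radius)
  then show ?thesis
  proof (rule has_radial_limit_cong[OF _ assms(2)])
    fix z :: complex assume "z \<noteq> 0" "cmod z < 1"
    then show "schur_step (- g) (f z) / z = h z"
      using f zh[of z] schur_step_minus[OF assms(3), of "z * h z"] by simp
  qed
qed

text \<open>This replaces Fatou's theorem: the boundary values of the individual Schur functions are
  obtained as roots of a quadratic equation whose coefficients have boundary values.\<close>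

lemma tendsto_of_power2:
  fixes Y :: "real \<Rightarrow> complex"
  assumes cont: "continuous_on {0<..<1} Y" and lim: "((\<lambda>r. (Y r)\<^sup>2) \<longlongrightarrow> D) (at_left 1)"
  shows "\<exists>y. (Y \<longlongrightarrow> y) (at_left 1)"
proof (cases "D = 0")
  case True
  have "((\<lambda>r. sqrt (cmod ((Y r)\<^sup>2))) \<longlongrightarrow> sqrt (cmod D)) (at_left 1)" by (intro tendsto_intros lim)
  then have "((\<lambda>r. cmod (Y r)) \<longlongrightarrow> 0) (at_left 1)" using True by (simp add: norm_power)
  then show ?thesis using tendsto_norm_zero_cancel by blast
next
  case False
  define Z where "Z = (\<lambda>r. Y r / csqrt D)"
  have s: "csqrt D \<noteq> 0" using False by simp
  have Z2: "((\<lambda>r. (Z r)\<^sup>2) \<longlongrightarrow> 1) (at_left 1)"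
    using tendsto_divide[OF lim tendsto_const[of D]] False by (simp add: Z_def power_divide)
  have "\<forall>\<^sub>F r in at_left 1. dist ((Z r)\<^sup>2) 1 < 1" using Z2 by (rule tendstoD) simp
  then obtain b where b: "b < 1" "\<And>r. b < r \<Longrightarrow> r < 1 \<Longrightarrow> dist ((Z r)\<^sup>2) 1 < 1"
    unfolding eventually_at_left[OF zero_less_one] by auto
  \<comment> \<open>On this interval \<open>(Z r)\<^sup>2\<close> is within distance 1 of 1, whereas
    a purely imaginary \<open>Z r\<close> would have a nonpositive square. So
    \<open>Re (Z r)\<close> never vanishes, and by connectedness it keeps one sign e.\<close>
  define I where "I = {max b 0<..<1::real}"
  have re: "Re (Z r) \<noteq> 0" if "r \<in> I" for r
  proof
    assume "Re (Z r) = 0"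
    then have "Re ((Z r)\<^sup>2) \<le> 0" by (simp add: power2_eq_square)
    moreover have "\<bar>Re ((Z r)\<^sup>2 - 1)\<bar> < 1"
      using b(2)[of r] that abs_Re_le_cmod[of "(Z r)\<^sup>2 - 1"] by (simp add: I_def dist_norm)
    ultimately show False by simp
  qed
  have contZ: "continuous_on I (\<lambda>r. Re (Z r))"
    unfolding Z_def using s by (intro continuous_intros continuous_on_subset[OF cont]) (auto simp: I_def)
  then have "connected ((\<lambda>r. Re (Z r)) ` I)" by (rule connected_continuous_image) (simp add: I_def)
  then have ivl: "\<And>x y. x \<in> I \<Longrightarrow> y \<in> I \<Longrightarrow> Re (Z x) \<le> 0 \<Longrightarrow> 0 \<le> Re (Z y) \<Longrightarrow> 0 \<in> (\<lambda>r. Re (Z r)) ` I"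
    unfolding connected_iff_interval by blast
  have "\<exists>e. (e = 1 \<or> e = -1) \<and> (\<forall>r\<in>I. 0 < e * Re (Z r))"
  proof (cases "\<forall>r\<in>I. 0 < Re (Z r)")
    case True then show ?thesis by (intro exI[of _ 1]) simp
  next
    case False
    then have "\<forall>r\<in>I. Re (Z r) < 0" using ivl re by (force simp: not_less)
    then show ?thesis by (intro exI[of _ "-1"]) simp
  qed
  then obtain e :: real where e: "e = 1 \<or> e = -1" "\<And>r. r \<in> I \<Longrightarrow> 0 < e * Re (Z r)" by blast
  \<comment> \<open>Factor Z^2 - 1 = (e Z - 1)(e Z + 1); the second factor has real part at least 1
    by the choice of the sign.\<close>
  have bound: "cmod (of_real e * Z r - 1) \<le> cmod ((Z r)\<^sup>2 - 1)" if "r \<in> I" for r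
  proof -
    have "1 \<le> Re (of_real e * Z r + 1)" using e(2)[OF that] by simp
    also have "\<dots> \<le> cmod (of_real e * Z r + 1)" by (rule complex_Re_le_cmod)
    finally have "cmod (of_real e * Z r - 1) * 1 \<le> cmod (of_real e * Z r - 1) * cmod (of_real e * Z r + 1)"
      by (intro mult_left_mono) auto
    also have "\<dots> = cmod ((Z r)\<^sup>2 - 1)"
      using e(1) by (auto simp: norm_mult[symmetric] power2_eq_square algebra_simps)
    finally show ?thesis by simp
  qed
  have "\<forall>\<^sub>F r in at_left 1. r \<in> I"
    unfolding eventually_at_left[OF zero_less_one] by (rule exI[of _ "max b 0"]) (use b in \<open>auto simp: I_def\<close>)
  then have "\<forall>\<^sub>F r in at_left 1. cmod (of_real e * Z r - 1) \<le> cmod ((Z r)\<^sup>2 - 1)"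
    by (rule eventually_mono) (rule bound)
  moreover have "((\<lambda>r. cmod ((Z r)\<^sup>2 - 1)) \<longlongrightarrow> 0) (at_left 1)"
    using tendsto_norm[OF tendsto_diff[OF Z2 tendsto_const[of 1]]] by simp
  ultimately have "((\<lambda>r. of_real e * Z r - 1) \<longlongrightarrow> 0) (at_left 1)" by (rule Lim_null_comparison)
  then have "((\<lambda>r. (of_real e * Z r - 1 + 1) * (of_real e * csqrt D)) \<longlongrightarrow> (0 + 1) * (of_real e * csqrt D)) (at_left 1)"
    by (intro tendsto_intros)
  moreover have "(of_real e * Z r - 1 + 1) * (of_real e * csqrt D) = Y r" for r
    using e(1) s by (auto simp: Z_def)
  ultimately show ?thesis by auto
qed

text \<open>U and V are the two roots of a quadratic with real coefficients.\<close>

lemma real_sum_prod_cases: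
  assumes "U + V \<in> \<real>" "U * V \<in> \<real>"
  shows "V = cnj U \<or> (U \<in> \<real> \<and> V \<in> \<real>)"
proof -
  have "Im V = - Im U" using assms(1) by (simp add: complex_is_Real_iff)
  moreover have "Re U * Im V + Im U * Re V = 0" using assms(2) by (simp add: complex_is_Real_iff)
  ultimately have "Im U * (Re V - Re U) = 0" by (simp add: algebra_simps)
  with \<open>Im V = - Im U\<close> show ?thesis by (auto simp: complex_is_Real_iff complex_eq_iff)
qed

section \<open>Products of Schur functions and the reflectionless identity at one boundary
  point\<close>

definition schur_product :: "(int \<Rightarrow> complex) \<Rightarrow> int \<Rightarrow> complex \<Rightarrow> complex" where
  "schur_product \<alpha> n z = z * f_plus \<alpha> n z * f_minus \<alpha> n z"

definition reflectionless_at :: "(int \<Rightarrow> complex) \<Rightarrow> complex \<Rightarrow> int \<Rightarrow> bool" where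
  "reflectionless_at \<alpha> w n \<longleftrightarrow> (\<exists>a b. has_radial_limit (f_plus \<alpha> n) w a \<and> has_radial_limit (f_minus \<alpha> n) w b \<and> w * a = cnj b)"

lemma f_plus_holomorphic:
  assumes "\<And>k. cmod (\<alpha> k) \<le> 1"
  shows "f_plus \<alpha> n holomorphic_on ball 0 1"
  unfolding f_plus_def using assms by (intro schur_fun_holomorphic) auto

lemma f_minus_holomorphic:
  assumes "\<And>k. cmod (\<alpha> k) \<le> 1"
  shows "f_minus \<alpha> n holomorphic_on ball 0 1"
  unfolding f_minus_def using assms by (intro schur_fun_holomorphic) auto

context
  fixes \<alpha> :: "int \<Rightarrow> complex"
  assumes \<alpha>: "\<And>k. cmod (\<alpha> k) \<le> 1"
begin

lemma f_plus_0: "f_plus \<alpha> n 0 = \<alpha> n"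
  unfolding f_plus_def using \<alpha> by (subst schur_fun_0) auto

lemma f_minus_0: "f_minus \<alpha> (n + 1) 0 = - cnj (\<alpha> n)"
  unfolding f_minus_def using \<alpha> by (subst schur_fun_0) auto

lemma schur_product_norm_less:
  assumes "cmod z < 1"
  shows "cmod (schur_product \<alpha> n z) < 1"
  unfolding schur_product_def mult.assoc
  using f_plus_norm_le[of \<alpha>, OF \<alpha> assms, of n] f_minus_norm_le[of \<alpha>, OF \<alpha> assms, of n]
  by (intro cmod_mult_less_1 assms) (simp add: norm_mult mult_le_one)

lemma f_plus_boundary:
  assumes "cmod (\<alpha> n) = 1" "cmod z < 1"
  shows "f_plus \<alpha> n z = \<alpha> n"
  using f_plus_rec[of \<alpha>, OF \<alpha> assms(2), of n] schur_step_boundary[OF assms(1)]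
    cmod_mult_less_1[OF assms(2) f_plus_norm_le[of \<alpha>, OF \<alpha> assms(2)]] by simp

lemma f_minus_boundary:
  assumes "cmod (\<alpha> n) = 1" "cmod z < 1"
  shows "f_minus \<alpha> (n + 1) z = - cnj (\<alpha> n)"
  using f_minus_rec[of \<alpha>, OF \<alpha> assms(2), of n] schur_step_boundary[of "- cnj (\<alpha> n)"]
    cmod_mult_less_1[OF assms(2) f_minus_norm_le[of \<alpha>, OF \<alpha> assms(2)]] assms(1) by simp

text \<open>A Schur step with parameter 0 is multiplication by z. This carries f_- across the gap
  between consecutive nonzero coefficients.\<close>

lemma f_minus_zero_run:
  assumes "\<And>i. i < k \<Longrightarrow> \<alpha> (n + int i) = 0" "cmod z < 1"
  shows "f_minus \<alpha> (n + int k) z = z ^ k * f_minus \<alpha> n z"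
  using assms(1)
proof (induction k)
  case (Suc k)
  have "f_minus \<alpha> (n + int k + 1) z = z * f_minus \<alpha> (n + int k) z"
    using f_minus_rec[of \<alpha>, OF \<alpha> assms(2), of "n + int k"] Suc.prems[of k] by (simp add: schur_step_def)
  then show ?case using Suc by (simp add: add_ac)
qed simp

context
  fixes w :: complex
  assumes w: "cmod w = 1"
begin

lemma w_cnj: "w \<noteq> 0" "cnj w * w = 1" "cnj w = 1 / w"
proof -
  show "w \<noteq> 0" using w by auto
  show c: "cnj w * w = 1" using w by (simp add: cmod_sq_complex[symmetric])
  show "cnj w = 1 / w" using c \<open>w \<noteq> 0\<close> by (simp add: eq_divide_eq)
qed

lemma limits_forward:
  assumes "cmod (\<alpha> j) < 1" "has_radial_limit (f_plus \<alpha> j) w a" "has_radial_limit (f_minus \<alpha> j) w b"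
  shows "has_radial_limit (f_plus \<alpha> (j + 1)) w (schur_step (- \<alpha> j) a / w)"
    and "has_radial_limit (f_minus \<alpha> (j + 1)) w (schur_step (- cnj (\<alpha> j)) (w * b))"
proof -
  show "has_radial_limit (f_plus \<alpha> (j + 1)) w (schur_step (- \<alpha> j) a / w)"
    by (rule has_radial_limit_schur_step_inverse[OF assms(2) w assms(1)])
      (erule f_plus_norm_le[of \<alpha>, OF \<alpha>], erule f_plus_rec[of \<alpha>, OF \<alpha>])
  show "has_radial_limit (f_minus \<alpha> (j + 1)) w (schur_step (- cnj (\<alpha> j)) (w * b))"
    by (rule has_radial_limit_schur_step[OF assms(3) w])
      (simp add: assms(1), erule f_minus_norm_le[of \<alpha>, OF \<alpha>], erule f_minus_rec[of \<alpha>, OF \<alpha>])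
qed

lemma limits_backward:
  assumes "cmod (\<alpha> j) < 1" "has_radial_limit (f_plus \<alpha> (j + 1)) w a" "has_radial_limit (f_minus \<alpha> (j + 1)) w b"
  shows "has_radial_limit (f_plus \<alpha> j) w (schur_step (\<alpha> j) (w * a))"
    and "has_radial_limit (f_minus \<alpha> j) w (schur_step (cnj (\<alpha> j)) b / w)"
proof -
  show "has_radial_limit (f_plus \<alpha> j) w (schur_step (\<alpha> j) (w * a))"
    by (rule has_radial_limit_schur_step[OF assms(2) w assms(1)])
      (erule f_plus_norm_le[of \<alpha>, OF \<alpha>], erule f_plus_rec[of \<alpha>, OF \<alpha>])
  have "has_radial_limit (f_minus \<alpha> j) w (schur_step (- (- cnj (\<alpha> j))) b / w)"
    by (rule has_radial_limit_schur_step_inverse[OF assms(3) w])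
      (simp add: assms(1), erule f_minus_norm_le[of \<alpha>, OF \<alpha>], erule f_minus_rec[of \<alpha>, OF \<alpha>])
  then show "has_radial_limit (f_minus \<alpha> j) w (schur_step (cnj (\<alpha> j)) b / w)" by simp
qed

text \<open>For |w| = 1 the identity w a = cnj b also reads w b = cnj a. The updates of f_+ and f_-
  apply steps with conjugate parameters to these conjugate numbers, so conjugation carries one
  update into the other.\<close>

lemma reflectionless_at_step:
  assumes "cmod (\<alpha> j) < 1"
  shows "reflectionless_at \<alpha> w (j + 1) \<longleftrightarrow> reflectionless_at \<alpha> w j"
proof
  assume "reflectionless_at \<alpha> w (j + 1)"
  then obtain a b where ab: "has_radial_limit (f_plus \<alpha> (j + 1)) w a" "has_radial_limit (f_minus \<alpha> (j + 1)) w b" "w * a = cnj b"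
    by (auto simp: reflectionless_at_def)
  have "w * schur_step (\<alpha> j) (w * a) = cnj (schur_step (cnj (\<alpha> j)) b / w)"
    using ab(3) w_cnj by (simp add: cnj_schur_step)
  then show "reflectionless_at \<alpha> w j"
    unfolding reflectionless_at_def using limits_backward[OF assms ab(1,2)] by blast
next
  assume "reflectionless_at \<alpha> w j"
  then obtain a b where ab: "has_radial_limit (f_plus \<alpha> j) w a" "has_radial_limit (f_minus \<alpha> j) w b" "w * a = cnj b"
    by (auto simp: reflectionless_at_def)
  have "cnj (w * b) = a" using ab(3)[symmetric] w_cnj by simp
  then have "w * (schur_step (- \<alpha> j) a / w) = cnj (schur_step (- cnj (\<alpha> j)) (w * b))"
    using w_cnj(1) by (simp add: cnj_schur_step)
  then show "reflectionless_at \<alpha> w (j + 1)"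
    unfolding reflectionless_at_def using limits_forward[OF assms ab(1,2)] by blast
qed

text \<open>With g = \<open>\<alpha> j\<close>, u = f_+, v = z f_- and P, P' the products at j and j
  + 1, one Schur step gives (1 - P')(1 - cnj g u)(1 - g v) = (1 - P)(1 - |g|^2). Expanding it
  expresses cnj g u + g v through P and P', and p' \<noteq> 1 keeps this expression finite at w. The
  product of the two terms is |g|^2 P, and g \<noteq> 0 allows u and v to be recovered from
  them.\<close>

lemma limits_at_nonzero:
  assumes nz: "\<alpha> j \<noteq> 0" and lt: "cmod (\<alpha> j) < 1"
    and p: "has_radial_limit (schur_product \<alpha> j) w p" "p \<in> \<real>"
    and p': "has_radial_limit (schur_product \<alpha> (j + 1)) w p'" "p' \<in> \<real>" "p' \<noteq> 1"
  shows "\<exists>a b. has_radial_limit (f_plus \<alpha> j) w a \<and> has_radial_limit (f_minus \<alpha> j) w b \<and>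
    (w * a = cnj b \<or> cnj (\<alpha> j) * a \<in> \<real> \<and> \<alpha> j * (w * b) \<in> \<real>)"
proof -
  let ?g = "\<alpha> j" and ?P = "schur_product \<alpha> j" and ?P' = "schur_product \<alpha> (j + 1)"
  define c where "c = cnj ?g * ?g"
  have c: "c \<in> \<real>" by (simp add: c_def cmod_sq_complex[symmetric] del: of_real_power)
  define u where "u = f_plus \<alpha> j"
  define v where "v = (\<lambda>z. z * f_minus \<alpha> j z)"
  define S where "S = (\<lambda>z. cnj ?g * u z + ?g * v z)"
  have uv: "u z * v z = ?P z" for z by (simp add: u_def v_def schur_product_def)
  have S: "S z = 1 + c * ?P z - (1 - ?P z) * (1 - c) / (1 - ?P' z)" if z: "cmod z < 1" for z
  proof -
    have u1: "cmod (u z) \<le> 1" unfolding u_def by (rule f_plus_norm_le[of \<alpha>, OF \<alpha> z])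
    have v1: "cmod (v z) \<le> 1" unfolding v_def using cmod_mult_less_1[OF z f_minus_norm_le[of \<alpha>, OF \<alpha> z]] by (rule less_imp_le)
    have "cmod (z * f_plus \<alpha> (j + 1) z) \<le> 1"
      using cmod_mult_less_1[OF z f_plus_norm_le[of \<alpha>, OF \<alpha> z]] by (rule less_imp_le)
    then have a: "z * f_plus \<alpha> (j + 1) z = schur_step (- ?g) (u z)"
      unfolding u_def f_plus_rec[of \<alpha>, OF \<alpha> z, of j] by (rule schur_step_minus[OF lt, symmetric])
    have b: "f_minus \<alpha> (j + 1) z = schur_step (- cnj ?g) (v z)"
      unfolding v_def by (rule f_minus_rec[of \<alpha>, OF \<alpha> z])
    have d1: "1 - cnj ?g * u z \<noteq> 0" using schur_step_denom_nz_closed[of "- ?g" "u z"] lt u1 by simp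
    have d2: "1 - ?g * v z \<noteq> 0" using schur_step_denom_nz_closed[of "- cnj ?g" "v z"] lt v1 by simp
    have "?P' z = ((u z - ?g) / (1 - cnj ?g * u z)) * ((v z - cnj ?g) / (1 - ?g * v z))"
      unfolding schur_product_def a b by (simp add: schur_step_def)
    then have "?P' z * ((1 - cnj ?g * u z) * (1 - ?g * v z)) = (u z - ?g) * (v z - cnj ?g)"
      using d1 d2 by simp
    then have "(1 - ?P' z) * ((1 - cnj ?g * u z) * (1 - ?g * v z)) = (1 - ?P z) * (1 - c)"
      unfolding uv[symmetric] c_def by (simp add: algebra_simps)
    moreover have "1 - ?P' z \<noteq> 0" using schur_product_norm_less[OF z, of "j + 1"] by auto
    ultimately have "(1 - cnj ?g * u z) * (1 - ?g * v z) = (1 - ?P z) * (1 - c) / (1 - ?P' z)"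
      by (simp add: eq_divide_eq mult.commute)
    moreover have "(1 - cnj ?g * u z) * (1 - ?g * v z) = 1 + c * ?P z - S z"
      unfolding uv[symmetric] c_def S_def by (simp add: algebra_simps)
    ultimately show ?thesis by (simp add: algebra_simps)
  qed
  define s where "s = 1 + c * p - (1 - p) * (1 - c) / (1 - p')"
  have "has_radial_limit (\<lambda>z. 1 + c * ?P z - (1 - ?P z) * (1 - c) / (1 - ?P' z)) w s"
    using p(1) p'(1,3) unfolding s_def has_radial_limit_def by (intro tendsto_intros) auto
  then have Slim: "has_radial_limit S w s" by (rule has_radial_limit_cong[OF _ w]) (use S in auto)
  have sR: "s \<in> \<real>" unfolding s_def using p p' c by (intro Reals_diff Reals_add Reals_mult Reals_divide) auto
  \<comment> \<open>A continuous square root of the discriminant S^2 - 4 |g|^2 P. Once it has a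
    limit, so do cnj g u = (S + Y) / 2 and g v = (S - Y) / 2.\<close>
  define Y where "Y = (\<lambda>z. cnj ?g * u z - ?g * v z)"
  have Y2: "(Y z)\<^sup>2 = (S z)\<^sup>2 - 4 * c * ?P z" for z
    unfolding uv[symmetric] c_def S_def Y_def by (simp add: power2_eq_square algebra_simps)
  have "((\<lambda>r. (Y (of_real r * w))\<^sup>2) \<longlongrightarrow> s\<^sup>2 - 4 * c * p) (at_left 1)"
    unfolding Y2 using Slim p(1) unfolding has_radial_limit_def by (intro tendsto_intros)
  moreover have "continuous_on {0<..<1} (\<lambda>r. Y (of_real r * w))"
    unfolding Y_def u_def v_def
    by (intro continuous_intros continuous_on_compose2[OF holomorphic_on_imp_continuous_on[OF f_plus_holomorphic[of \<alpha>, OF \<alpha>]]]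
        continuous_on_compose2[OF holomorphic_on_imp_continuous_on[OF f_minus_holomorphic[of \<alpha>, OF \<alpha>]]])
      (use w in \<open>auto simp: norm_mult\<close>)
  ultimately obtain y where y: "has_radial_limit Y w y"
    using tendsto_of_power2[of "\<lambda>r. Y (of_real r * w)"] by (auto simp: has_radial_limit_def)
  define a where "a = (s + y) / (2 * cnj ?g)"
  define b where "b = (s - y) / (2 * ?g) / w"
  have "has_radial_limit (\<lambda>z. (S z + Y z) / (2 * cnj ?g)) w a"
    unfolding a_def has_radial_limit_def using Slim y nz unfolding has_radial_limit_def by (intro tendsto_intros) auto
  then have alim: "has_radial_limit (f_plus \<alpha> j) w a"
    by (rule has_radial_limit_cong[OF _ w]) (use nz in \<open>auto simp: S_def Y_def u_def\<close>)
  have "has_radial_limit (\<lambda>z. (S z - Y z) / (2 * ?g) / z) w b"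
    unfolding b_def has_radial_limit_def using Slim y nz w_cnj(1) unfolding has_radial_limit_def
    by (intro tendsto_intros tendsto_radius) auto
  then have blim: "has_radial_limit (f_minus \<alpha> j) w b"
    by (rule has_radial_limit_cong[OF _ w]) (use nz in \<open>auto simp: S_def Y_def v_def\<close>)
  have "has_radial_limit ?P w (w * a * b)"
    using alim blim unfolding has_radial_limit_def schur_product_def by (intro tendsto_intros tendsto_radius)
  then have wab: "w * a * b = p" using has_radial_limit_unique p(1) by blast
  let ?U = "cnj ?g * a" and ?V = "?g * (w * b)"
  have "?U + ?V = s" using nz w_cnj(1) by (simp add: a_def b_def field_simps)
  moreover have "?U * ?V = c * p" unfolding wab[symmetric] c_def by (simp add: mult_ac)
  ultimately have "?V = cnj ?U \<or> (?U \<in> \<real> \<and> ?V \<in> \<real>)"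
    using sR c p by (intro real_sum_prod_cases) auto
  moreover have "w * a = cnj b" if "?V = cnj ?U"
  proof -
    have "w * b = cnj a" using that nz by simp
    then have "cnj w * cnj b = a" by (metis complex_cnj_cnj complex_cnj_mult)
    then show ?thesis using w_cnj by (simp add: field_simps)
  qed
  ultimately show ?thesis using alim blim by blast
qed

text \<open>A unimodular \<open>\<alpha> k\<close> makes f_+ constant at k and f_- constant at k +
  1, so the identity would prescribe the boundary value of the other function. The two excluded
  functions take the nonzero values - cnj (\<open>\<alpha> k\<close>) and \<open>\<alpha> k\<close>
  at 0, so the exclusion holds almost everywhere.\<close>

lemma boundary_not_reflectionless:
  assumes "cmod (\<alpha> k) = 1"
    and "\<not> has_radial_limit (\<lambda>z. z * f_minus \<alpha> k z - cnj (\<alpha> k)) w 0"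
    and "\<not> has_radial_limit (\<lambda>z. z * f_plus \<alpha> (k + 1) z + \<alpha> k) w 0"
  shows "\<not> reflectionless_at \<alpha> w k" "\<not> reflectionless_at \<alpha> w (k + 1)"
proof -
  show "\<not> reflectionless_at \<alpha> w k"
  proof
    assume "reflectionless_at \<alpha> w k"
    then obtain a b where a: "has_radial_limit (f_plus \<alpha> k) w a" and b: "has_radial_limit (f_minus \<alpha> k) w b" and ab: "w * a = cnj b"
      by (auto simp: reflectionless_at_def)
    have "has_radial_limit (\<lambda>z. \<alpha> k) w a"
      by (rule has_radial_limit_cong[OF a w]) (use f_plus_boundary[OF assms(1)] in auto)
    then have "a = \<alpha> k" by (rule has_radial_limit_unique) (simp add: has_radial_limit_def)
    then have "b = cnj w * cnj (\<alpha> k)" using arg_cong[OF ab, of cnj] by simp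
    then have "w * b - cnj (\<alpha> k) = 0" using w_cnj by simp
    moreover have "has_radial_limit (\<lambda>z. z * f_minus \<alpha> k z - cnj (\<alpha> k)) w (w * b - cnj (\<alpha> k))"
      using b unfolding has_radial_limit_def by (intro tendsto_intros tendsto_radius)
    ultimately show False using assms(2) by simp
  qed
  show "\<not> reflectionless_at \<alpha> w (k + 1)"
  proof
    assume "reflectionless_at \<alpha> w (k + 1)"
    then obtain a b where a: "has_radial_limit (f_plus \<alpha> (k + 1)) w a" and b: "has_radial_limit (f_minus \<alpha> (k + 1)) w b" and ab: "w * a = cnj b"
      by (auto simp: reflectionless_at_def)
    have "has_radial_limit (\<lambda>z. - cnj (\<alpha> k)) w b"
      by (rule has_radial_limit_cong[OF b w]) (use f_minus_boundary[OF assms(1)] in auto)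
    then have "b = - cnj (\<alpha> k)" by (rule has_radial_limit_unique) (simp add: has_radial_limit_def)
    then have "w * a + \<alpha> k = 0" using ab by simp
    moreover have "has_radial_limit (\<lambda>z. z * f_plus \<alpha> (k + 1) z + \<alpha> k) w (w * a + \<alpha> k)"
      using a unfolding has_radial_limit_def by (intro tendsto_intros tendsto_radius)
    ultimately show False using assms(3) by simp
  qed
qed

text \<open>The hypotheses gather, at a single w, what is known off a null set; the rest of the
  converse is then an argument at one boundary point.\<close>

lemma reflectionless_at_all:
  assumes prod: "\<And>j. \<exists>p. has_radial_limit (schur_product \<alpha> j) w p \<and> p \<in> \<real> \<and> p \<noteq> 1"
    and plus_nz: "\<And>j. \<alpha> j \<noteq> 0 \<Longrightarrow> \<not> has_radial_limit (f_plus \<alpha> j) w 0"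
    and minus_nz: "\<And>j. \<alpha> j \<noteq> 0 \<Longrightarrow> \<not> has_radial_limit (f_minus \<alpha> (j + 1)) w 0"
    and bd_minus: "\<And>k. cmod (\<alpha> k) = 1 \<Longrightarrow> \<not> has_radial_limit (\<lambda>z. z * f_minus \<alpha> k z - cnj (\<alpha> k)) w 0"
    and bd_plus: "\<And>k. cmod (\<alpha> k) = 1 \<Longrightarrow> \<not> has_radial_limit (\<lambda>z. z * f_plus \<alpha> (k + 1) z + \<alpha> k) w 0"
    and generic: "\<And>i j d. \<alpha> i \<noteq> 0 \<Longrightarrow> \<alpha> j \<noteq> 0 \<Longrightarrow> w ^ Suc d * (\<alpha> j * cnj (\<alpha> i)) \<notin> \<real>"
    and nz: "\<alpha> n \<noteq> 0" "\<alpha> (n + 1 + int k) \<noteq> 0" and run: "\<And>i. i < k \<Longrightarrow> \<alpha> (n + 1 + int i) = 0"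
  shows "reflectionless_at \<alpha> w i"
proof -
  let ?m = "n + 1 + int k"
  \<comment> \<open>At a unimodular coefficient the equivalence holds because both sides are
    false.\<close>
  have step: "reflectionless_at \<alpha> w (j + 1) \<longleftrightarrow> reflectionless_at \<alpha> w j" for j
  proof (cases "cmod (\<alpha> j) < 1")
    case False
    then have "cmod (\<alpha> j) = 1" using \<alpha>[of j] by simp
    then show ?thesis using boundary_not_reflectionless[of j] bd_minus[of j] bd_plus[of j] by blast
  qed (rule reflectionless_at_step)
  have all: "reflectionless_at \<alpha> w i" if "reflectionless_at \<alpha> w j" for j
  proof (induction i rule: int_induct[of _ j])
    case (step2 i)
    then show ?case using step[of "i - 1"] by simp
  qed (use that step in auto)
  \<comment> \<open>The second alternatives say that x is a real multiple of
    \<open>\<alpha> j\<close> and y one of cnj (\<open>\<alpha> j\<close>). For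
    |\<open>\<alpha> j\<close>| = 1 they hold trivially, since f_+ at j and f_- at j + 1 are then
    constants of this form.\<close>
  have right: "reflectionless_at \<alpha> w j \<or> (\<exists>x. has_radial_limit (f_plus \<alpha> j) w x \<and> cnj (\<alpha> j) * x \<in> \<real>)"
    and left: "reflectionless_at \<alpha> w j \<or> (\<exists>y. has_radial_limit (f_minus \<alpha> (j + 1)) w y \<and> \<alpha> j * y \<in> \<real>)"
    if j: "\<alpha> j \<noteq> 0" for j
  proof -
    have r: "cnj (\<alpha> j) * \<alpha> j \<in> \<real>" by (simp add: cmod_sq_complex[symmetric] del: of_real_power)
    have "(reflectionless_at \<alpha> w j \<or> (\<exists>x. has_radial_limit (f_plus \<alpha> j) w x \<and> cnj (\<alpha> j) * x \<in> \<real>)) \<and>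
      (reflectionless_at \<alpha> w j \<or> (\<exists>y. has_radial_limit (f_minus \<alpha> (j + 1)) w y \<and> \<alpha> j * y \<in> \<real>))"
    proof (cases "cmod (\<alpha> j) < 1")
      case True
      obtain p p' where "has_radial_limit (schur_product \<alpha> j) w p" "p \<in> \<real>"
        "has_radial_limit (schur_product \<alpha> (j + 1)) w p'" "p' \<in> \<real>" "p' \<noteq> 1"
        using prod[of j] prod[of "j + 1"] by blast
      from limits_at_nonzero[OF j True this] obtain a b where
        a: "has_radial_limit (f_plus \<alpha> j) w a" and b: "has_radial_limit (f_minus \<alpha> j) w b" and
        ab: "w * a = cnj b \<or> cnj (\<alpha> j) * a \<in> \<real> \<and> \<alpha> j * (w * b) \<in> \<real>" by blast
      show ?thesis
      proof (cases "w * a = cnj b")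
        case True
        then show ?thesis using a b by (auto simp: reflectionless_at_def)
      next
        case False
        then have re: "cnj (\<alpha> j) * a \<in> \<real>" "\<alpha> j * (w * b) \<in> \<real>" using ab by auto
        \<comment> \<open>Realness is moved from f_- at j to f_- at j + 1, from which the run of
          zeros leads to the next nonzero site.\<close>
        have "\<alpha> j * schur_step (- cnj (\<alpha> j)) (w * b) = (\<alpha> j * (w * b) - cnj (\<alpha> j) * \<alpha> j) / (1 - \<alpha> j * (w * b))"
          by (simp add: schur_step_def algebra_simps)
        also have "\<dots> \<in> \<real>" using re r by (intro Reals_divide Reals_diff) auto
        finally show ?thesis using limits_forward(2)[OF True a b] a re(1) by blast
      qed
    next
      case False
      then have b1: "cmod (\<alpha> j) = 1" using \<alpha>[of j] by simp
      have const: "has_radial_limit (\<lambda>z. l) w l" for l by (simp add: has_radial_limit_def)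
      have "has_radial_limit (f_plus \<alpha> j) w (\<alpha> j)"
        by (rule has_radial_limit_cong[OF const w]) (use f_plus_boundary[OF b1] in auto)
      moreover have "has_radial_limit (f_minus \<alpha> (j + 1)) w (- cnj (\<alpha> j))"
        by (rule has_radial_limit_cong[OF const w]) (use f_minus_boundary[OF b1] in auto)
      moreover have "\<alpha> j * - cnj (\<alpha> j) \<in> \<real>" using Reals_minus[OF r] by (simp add: mult.commute)
      ultimately show ?thesis using r by blast
    qed
    then show "reflectionless_at \<alpha> w j \<or> (\<exists>x. has_radial_limit (f_plus \<alpha> j) w x \<and> cnj (\<alpha> j) * x \<in> \<real>)"
      "reflectionless_at \<alpha> w j \<or> (\<exists>y. has_radial_limit (f_minus \<alpha> (j + 1)) w y \<and> \<alpha> j * y \<in> \<real>)" by auto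
  qed
  show ?thesis
  proof (rule ccontr)
    assume "\<not> reflectionless_at \<alpha> w i"
    then have no: "\<not> reflectionless_at \<alpha> w j" for j using all by blast
    obtain x where x: "has_radial_limit (f_plus \<alpha> ?m) w x" "cnj (\<alpha> ?m) * x \<in> \<real>" using right[OF nz(2)] no by blast
    obtain y where y: "has_radial_limit (f_minus \<alpha> (n + 1)) w y" "\<alpha> n * y \<in> \<real>" using left[OF nz(1)] no by blast
    have "x \<noteq> 0" "y \<noteq> 0" using x y plus_nz[OF nz(2)] minus_nz[OF nz(1)] by auto
    obtain p where p: "has_radial_limit (schur_product \<alpha> ?m) w p" "p \<in> \<real>" using prod by blast
    have "has_radial_limit (\<lambda>z. z * f_plus \<alpha> ?m z * (z ^ k * f_minus \<alpha> (n + 1) z)) w (w * x * (w ^ k * y))"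
      using x(1) y(1) unfolding has_radial_limit_def by (intro tendsto_intros tendsto_radius)
    then have "has_radial_limit (schur_product \<alpha> ?m) w (w * x * (w ^ k * y))"
      by (rule has_radial_limit_cong[OF _ w]) (simp add: schur_product_def f_minus_zero_run[OF run])
    then have r1: "w * x * (w ^ k * y) \<in> \<real>" using has_radial_limit_unique[OF _ p(1)] p(2) by metis
    \<comment> \<open>By the zero run the boundary value of the product at \<open>?m\<close> is w x
      w^k y. As x and y are nonzero real multiples of \<open>\<alpha> ?m\<close> and cnj
      (\<open>\<alpha> n\<close>), its realness passes to w^(k+1) \<open>\<alpha> ?m\<close> cnj
      (\<open>\<alpha> n\<close>), with exponent the distance of the two sites.\<close>
    have eq: "w ^ Suc k * (\<alpha> ?m * cnj (\<alpha> n))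
        = w * x * (w ^ k * y) * (cnj (\<alpha> ?m) * \<alpha> ?m) * (cnj (\<alpha> n) * \<alpha> n) / ((cnj (\<alpha> ?m) * x) * (\<alpha> n * y))"
      using \<open>x \<noteq> 0\<close> \<open>y \<noteq> 0\<close> nz by simp
    have r2: "cnj (\<alpha> j) * \<alpha> j \<in> \<real>" for j by (simp add: cmod_sq_complex[symmetric] del: of_real_power)
    have "w ^ Suc k * (\<alpha> ?m * cnj (\<alpha> n)) \<in> \<real>"
      unfolding eq by (rule Reals_divide[OF Reals_mult[OF Reals_mult[OF r1 r2] r2] Reals_mult[OF x(2) y(2)]])
    then show False using generic[OF nz] by blast
  qed
qed

end

end

section \<open>Exceptional null sets and the two implications\<close>

lemma consecutive_nonzero:
  assumes "\<exists>m n. m \<noteq> n \<and> \<alpha> m \<noteq> 0 \<and> \<alpha> n \<noteq> (0::complex)"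
  obtains n :: int and k where "\<alpha> n \<noteq> 0" "\<alpha> (n + 1 + int k) \<noteq> 0" "\<And>i. i < k \<Longrightarrow> \<alpha> (n + 1 + int i) = 0"
proof -
  obtain n m where nm: "n < m" "\<alpha> n \<noteq> 0" "\<alpha> m \<noteq> 0" using assms by (metis linorder_neqE)
  define k where "k = (LEAST k. \<alpha> (n + 1 + int k) \<noteq> 0)"
  have "\<alpha> (n + 1 + int (nat (m - n - 1))) \<noteq> 0" using nm by simp
  then have "\<alpha> (n + 1 + int k) \<noteq> 0" unfolding k_def by (rule LeastI)
  moreover have "\<alpha> (n + 1 + int i) = 0" if "i < k" for i using not_less_Least[OF that[unfolded k_def]] by simp
  ultimately show thesis using that nm by blast
qed

text \<open>For |q| = 1, the number q c is real exactly if q^2 c = cnj c. The polynomial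
  \<open>h\<close> expressing this has the value - cnj c \<noteq> 0 at 0, so the boundary uniqueness
  theorem applies to it.\<close>

lemma ae_not_real_multiple:
  assumes "c \<noteq> 0"
  shows "AE t in lebesgue_on {0..2*pi}. cis t ^ Suc d * c \<notin> \<real>"
proof -
  define h where "h = (\<lambda>z. (z ^ Suc d)\<^sup>2 * c - cnj c)"
  have "AE t in lebesgue_on {0..2*pi}. \<not> has_radial_limit h (cis t) 0"
  proof (rule ae_radial_limit_nonzero)
    show "h holomorphic_on ball 0 1" unfolding h_def by (intro holomorphic_intros)
    show "h 0 \<noteq> 0" using assms by (simp add: h_def)
    fix z :: complex assume "z \<in> ball 0 1"
    then have "cmod ((z ^ Suc d)\<^sup>2) \<le> 1" by (simp add: norm_power norm_mult power_le_one mult_le_one)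
    then have "cmod ((z ^ Suc d)\<^sup>2 * c) \<le> 1 * cmod c" unfolding norm_mult by (intro mult_right_mono) auto
    then show "cmod (h z) \<le> cmod c + cmod c"
      unfolding h_def using norm_triangle_ineq4[of "(z ^ Suc d)\<^sup>2 * c" "cnj c"] by simp
  qed
  then show ?thesis
  proof (rule AE_mp, intro AE_I2 impI notI)
    fix t assume n: "\<not> has_radial_limit h (cis t) 0" and r: "cis t ^ Suc d * c \<in> \<real>"
    let ?q = "cis t ^ Suc d"
    have q1: "cnj ?q * ?q = 1" unfolding cmod_sq_complex[symmetric] by (simp add: norm_power norm_mult)
    have qc: "?q * c = cnj ?q * cnj c" using r unfolding Reals_cnj_iff complex_cnj_mult by (rule sym)
    have "?q * (?q * c) = (cnj ?q * ?q) * cnj c" unfolding qc by (simp only: mult_ac)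
    then have "?q * (?q * c) = cnj c" unfolding q1 by simp
    then have "h (cis t) = 0" unfolding h_def power2_eq_square mult.assoc by simp
    moreover have "has_radial_limit h (cis t) (h (cis t))"
      unfolding has_radial_limit_def h_def by (intro tendsto_intros tendsto_radius)
    ultimately show False using n by simp
  qed
qed

text \<open>The inverse Cayley transform P = (F - 1) / (F + 1). Since Re F \<ge> 0, the limit l is
  not -1. That l is finite shows up as p \<noteq> 1, which the solution for the sum in
  \<open>limits_at_nonzero\<close> divides by.\<close>

lemma schur_product_limit_of_caratheodory:
  assumes \<alpha>: "\<And>n. cmod (\<alpha> n) \<le> 1" and w: "cmod w = 1" and \<mu>: "is_spectral_measure \<alpha> j \<nu>"
    and l: "has_radial_limit (caratheodory \<nu>) w l" "Im l = 0"
  shows "\<exists>p. has_radial_limit (schur_product \<alpha> j) w p \<and> p \<in> \<real> \<and> p \<noteq> 1"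
proof -
  let ?P = "schur_product \<alpha> j" and ?F = "caratheodory \<nu>"
  have F: "?F z = (1 + ?P z) / (1 - ?P z)" if "cmod z < 1" for z
    using caratheodory_spectral_measure[of \<alpha>, OF \<alpha> that \<mu>] by (simp add: schur_product_def)
  have P: "1 - ?P z \<noteq> 0" if "cmod z < 1" for z using schur_product_norm_less[of \<alpha>, OF \<alpha> that, of j] by auto
  have Re: "0 \<le> Re (?F z)" if "cmod z < 1" for z
  proof -
    have "Re ((1 + ?P z) * cnj (1 - ?P z)) = 1 - (cmod (?P z))\<^sup>2"
      unfolding cmod_power2 by (simp add: power2_eq_square algebra_simps)
    also have "\<dots> \<ge> 0" using schur_product_norm_less[of \<alpha>, OF \<alpha> that, of j] by (simp add: abs_square_le_1)
    finally show ?thesis unfolding F[OF that] by (subst complex_div_cnj) (simp add: Re_divide_of_real[of _ "(cmod _)\<^sup>2", simplified])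
  qed
  have "0 \<le> Re l"
    by (rule tendsto_lowerbound[OF tendsto_Re[OF l(1)[unfolded has_radial_limit_def]]])
      (use eventually_radial[OF w, of "\<lambda>z. 0 \<le> Re (?F z)"] Re in auto)
  then have l1: "l + 1 \<noteq> 0" by (auto simp: complex_eq_iff)
  have "has_radial_limit (\<lambda>z. (?F z - 1) / (?F z + 1)) w ((l - 1) / (l + 1))"
    using l(1) l1 unfolding has_radial_limit_def by (intro tendsto_intros)
  then have "has_radial_limit ?P w ((l - 1) / (l + 1))"
  proof (rule has_radial_limit_cong[OF _ w])
    fix z :: complex assume z: "cmod z < 1"
    have "?F z - 1 = 2 * ?P z / (1 - ?P z)" "?F z + 1 = 2 / (1 - ?P z)"
      unfolding F[OF z] using P[OF z] by (simp_all add: field_simps)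
    then show "(?F z - 1) / (?F z + 1) = ?P z" using P[OF z] by simp
  qed
  moreover have "(l - 1) / (l + 1) \<in> \<real>" using l(2) by (intro Reals_divide Reals_diff Reals_add) (auto simp: complex_is_Real_iff)
  moreover have "(l - 1) / (l + 1) \<noteq> 1" using l1 by (simp add: divide_eq_eq)
  ultimately show ?thesis by blast
qed

text \<open>The limit of the product is cnj b * b and hence real. What has to be excluded is the
  value 1, a pole of the Cayley transform.\<close>

lemma caratheodory_limit_of_reflectionless:
  assumes \<alpha>: "\<And>n. cmod (\<alpha> n) \<le> 1" and w: "cmod w = 1" and \<mu>: "is_spectral_measure \<alpha> j \<nu>"
    and r: "reflectionless_at \<alpha> w j" and n1: "\<not> has_radial_limit (\<lambda>z. 1 - schur_product \<alpha> j z) w 0"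
  shows "\<exists>l. has_radial_limit (caratheodory \<nu>) w l \<and> Im l = 0"
proof -
  obtain a b where a: "has_radial_limit (f_plus \<alpha> j) w a" and b: "has_radial_limit (f_minus \<alpha> j) w b" and ab: "w * a = cnj b"
    using r by (auto simp: reflectionless_at_def)
  let ?p = "w * a * b"
  have p: "has_radial_limit (schur_product \<alpha> j) w ?p"
    using a b unfolding has_radial_limit_def schur_product_def by (intro tendsto_intros tendsto_radius)
  have "has_radial_limit (\<lambda>z. 1 - schur_product \<alpha> j z) w (1 - ?p)"
    using p unfolding has_radial_limit_def by (intro tendsto_intros)
  then have p1: "1 - ?p \<noteq> 0" using n1 by auto
  have "?p \<in> \<real>" unfolding ab by (simp add: cmod_sq_complex[symmetric] del: of_real_power)
  then have "(1 + ?p) / (1 - ?p) \<in> \<real>" by (intro Reals_divide Reals_diff Reals_add) auto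
  moreover have "has_radial_limit (\<lambda>z. (1 + schur_product \<alpha> j z) / (1 - schur_product \<alpha> j z)) w ((1 + ?p) / (1 - ?p))"
    using p p1 unfolding has_radial_limit_def by (intro tendsto_intros)
  then have "has_radial_limit (caratheodory \<nu>) w ((1 + ?p) / (1 - ?p))"
    by (rule has_radial_limit_cong[OF _ w]) (simp add: caratheodory_spectral_measure[of \<alpha>, OF \<alpha> _ \<mu>] schur_product_def)
  ultimately show ?thesis by (auto simp: complex_is_Real_iff)
qed

theorem theorem1p8:
  fixes \<alpha> :: "int \<Rightarrow> complex" and \<mu> :: "int \<Rightarrow> complex measure" and A :: "complex set"
  assumes "\<And>n. cmod (\<alpha> n) \<le> 1"
    and "\<exists>m n. m \<noteq> n \<and> \<alpha> m \<noteq> 0 \<and> \<alpha> n \<noteq> 0"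
    and "\<And>n. is_spectral_measure \<alpha> n (\<mu> n)"
    and "A \<in> sets borel" and "A \<subseteq> sphere 0 1"
  shows "reflectionless_cmv \<alpha> A \<longleftrightarrow> (\<forall>n. reflectionless_measure (\<mu> n) A)"
proof
  let ?M = "lebesgue_on {0..2*pi}"
  note \<alpha> = assms(1) and \<mu> = assms(3)
  have hp: "f_plus \<alpha> j holomorphic_on ball 0 1" and hm: "f_minus \<alpha> j holomorphic_on ball 0 1" for j
    by (rule f_plus_holomorphic[of \<alpha>, OF \<alpha>], rule f_minus_holomorphic[of \<alpha>, OF \<alpha>])
  have bp: "cmod (f_plus \<alpha> j z) \<le> 1" and bm: "cmod (f_minus \<alpha> j z) \<le> 1"
    and bzp: "cmod (z * f_plus \<alpha> j z) \<le> 1" and bzm: "cmod (z * f_minus \<alpha> j z) \<le> 1" if "z \<in> ball 0 1" for j z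
    using f_plus_norm_le[of \<alpha>, OF \<alpha>, of z j] f_minus_norm_le[of \<alpha>, OF \<alpha>, of z j] that
    by (auto simp: norm_mult mult_le_one)
  {
    assume refl: "reflectionless_cmv \<alpha> A"
    show "\<forall>n. reflectionless_measure (\<mu> n) A"
    proof
      fix n
      have "AE t in ?M. \<not> has_radial_limit (\<lambda>z. 1 - schur_product \<alpha> n z) (cis t) 0"
      proof (rule ae_radial_limit_nonzero)
        show "(\<lambda>z. 1 - schur_product \<alpha> n z) holomorphic_on ball 0 1"
          unfolding schur_product_def by (intro holomorphic_intros hp hm)
        show "cmod (1 - schur_product \<alpha> n z) \<le> 2" if "z \<in> ball 0 1" for z
          using norm_triangle_ineq4[of 1 "schur_product \<alpha> n z"] schur_product_norm_less[of \<alpha>, OF \<alpha>, of z n] that by simp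
      qed (simp add: schur_product_def)
      moreover have "AE t in ?M. cis t \<in> A \<longrightarrow> reflectionless_at \<alpha> (cis t) n"
        using refl by (simp add: reflectionless_cmv_def ae_on_circle_def reflectionless_at_def)
      ultimately show "reflectionless_measure (\<mu> n) A"
        unfolding reflectionless_measure_def ae_on_circle_def
      proof eventually_elim
        case (elim t)
        then show ?case using caratheodory_limit_of_reflectionless[of \<alpha>, OF \<alpha> norm_cis \<mu>] by blast
      qed
    qed
  next
    assume refl: "\<forall>n. reflectionless_measure (\<mu> n) A"
    obtain n k where nk: "\<alpha> n \<noteq> 0" "\<alpha> (n + 1 + int k) \<noteq> 0" "\<And>i. i < k \<Longrightarrow> \<alpha> (n + 1 + int i) = 0"
      using consecutive_nonzero[OF assms(2)] by metis
    \<comment> \<open>Each of the six conditions is indexed by a countable family, so a single null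
      set serves all sites at once.\<close>
    have 1: "AE t in ?M. \<forall>j. cis t \<in> A \<longrightarrow> (\<exists>l. has_radial_limit (caratheodory (\<mu> j)) (cis t) l \<and> Im l = 0)"
      unfolding AE_all_countable using refl by (simp add: reflectionless_measure_def ae_on_circle_def)
    have 2: "AE t in ?M. \<forall>j. \<alpha> j \<noteq> 0 \<longrightarrow> \<not> has_radial_limit (f_plus \<alpha> j) (cis t) 0"
      unfolding AE_all_countable
    proof
      fix j
      show "AE t in ?M. \<alpha> j \<noteq> 0 \<longrightarrow> \<not> has_radial_limit (f_plus \<alpha> j) (cis t) 0"
      proof (cases "\<alpha> j = 0")
        case False
        have "AE t in ?M. \<not> has_radial_limit (f_plus \<alpha> j) (cis t) 0"
          by (rule ae_radial_limit_nonzero[OF hp]) (erule bp, simp add: f_plus_0[of \<alpha>, OF \<alpha>] False)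
        then show ?thesis by eventually_elim simp
      qed simp
    qed
    have 3: "AE t in ?M. \<forall>j. \<alpha> j \<noteq> 0 \<longrightarrow> \<not> has_radial_limit (f_minus \<alpha> (j + 1)) (cis t) 0"
      unfolding AE_all_countable
    proof
      fix j
      show "AE t in ?M. \<alpha> j \<noteq> 0 \<longrightarrow> \<not> has_radial_limit (f_minus \<alpha> (j + 1)) (cis t) 0"
      proof (cases "\<alpha> j = 0")
        case False
        have "AE t in ?M. \<not> has_radial_limit (f_minus \<alpha> (j + 1)) (cis t) 0"
          by (rule ae_radial_limit_nonzero[OF hm]) (erule bm, simp add: f_minus_0[of \<alpha>, OF \<alpha>] False)
        then show ?thesis by eventually_elim simp
      qed simp
    qed
    have 4: "AE t in ?M. \<forall>j. cmod (\<alpha> j) = 1 \<longrightarrow> \<not> has_radial_limit (\<lambda>z. z * f_minus \<alpha> j z - cnj (\<alpha> j)) (cis t) 0"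
      unfolding AE_all_countable
    proof
      fix j
      have "AE t in ?M. \<not> has_radial_limit (\<lambda>z. z * f_minus \<alpha> j z - cnj (\<alpha> j)) (cis t) 0" if "cmod (\<alpha> j) = 1"
      proof (rule ae_radial_limit_nonzero)
        show "(\<lambda>z. z * f_minus \<alpha> j z - cnj (\<alpha> j)) holomorphic_on ball 0 1" by (intro holomorphic_intros hm)
        show "cmod (z * f_minus \<alpha> j z - cnj (\<alpha> j)) \<le> 2" if "z \<in> ball 0 1" for z
          using norm_triangle_ineq4[of "z * f_minus \<alpha> j z" "cnj (\<alpha> j)"] bzm[OF that, of j] \<alpha>[of j] by simp
      qed (use that in auto)
      then show "AE t in ?M. cmod (\<alpha> j) = 1 \<longrightarrow> \<not> has_radial_limit (\<lambda>z. z * f_minus \<alpha> j z - cnj (\<alpha> j)) (cis t) 0"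
        by (cases "cmod (\<alpha> j) = 1") auto
    qed
    have 5: "AE t in ?M. \<forall>j. cmod (\<alpha> j) = 1 \<longrightarrow> \<not> has_radial_limit (\<lambda>z. z * f_plus \<alpha> (j + 1) z + \<alpha> j) (cis t) 0"
      unfolding AE_all_countable
    proof
      fix j
      have "AE t in ?M. \<not> has_radial_limit (\<lambda>z. z * f_plus \<alpha> (j + 1) z + \<alpha> j) (cis t) 0" if "cmod (\<alpha> j) = 1"
      proof (rule ae_radial_limit_nonzero)
        show "(\<lambda>z. z * f_plus \<alpha> (j + 1) z + \<alpha> j) holomorphic_on ball 0 1" by (intro holomorphic_intros hp)
        show "cmod (z * f_plus \<alpha> (j + 1) z + \<alpha> j) \<le> 2" if "z \<in> ball 0 1" for z
          using norm_triangle_ineq[of "z * f_plus \<alpha> (j + 1) z" "\<alpha> j"] bzp[OF that, of "j + 1"] \<alpha>[of j] by simp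
      qed (use that in auto)
      then show "AE t in ?M. cmod (\<alpha> j) = 1 \<longrightarrow> \<not> has_radial_limit (\<lambda>z. z * f_plus \<alpha> (j + 1) z + \<alpha> j) (cis t) 0"
        by (cases "cmod (\<alpha> j) = 1") auto
    qed
    have 6: "AE t in ?M. \<forall>i j d. \<alpha> i \<noteq> 0 \<longrightarrow> \<alpha> j \<noteq> 0 \<longrightarrow> cis t ^ Suc d * (\<alpha> j * cnj (\<alpha> i)) \<notin> \<real>"
      unfolding AE_all_countable
    proof (intro allI)
      fix i j d
      show "AE t in ?M. \<alpha> i \<noteq> 0 \<longrightarrow> \<alpha> j \<noteq> 0 \<longrightarrow> cis t ^ Suc d * (\<alpha> j * cnj (\<alpha> i)) \<notin> \<real>"
        using ae_not_real_multiple[of "\<alpha> j * cnj (\<alpha> i)" d]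
        by (cases "\<alpha> i = 0 \<or> \<alpha> j = 0") auto
    qed
    have "AE t in ?M. cis t \<in> A \<longrightarrow> (\<forall>i. reflectionless_at \<alpha> (cis t) i)"
      using 1 2 3 4 5 6
    proof eventually_elim
      case (elim t)
      show ?case
      proof (intro impI allI)
        fix i assume A: "cis t \<in> A"
        show "reflectionless_at \<alpha> (cis t) i"
        proof (rule reflectionless_at_all[of \<alpha>, OF \<alpha> norm_cis _ _ _ _ _ _ nk])
          show "\<exists>p. has_radial_limit (schur_product \<alpha> j) (cis t) p \<and> p \<in> \<real> \<and> p \<noteq> 1" for j
            using elim(1) A schur_product_limit_of_caratheodory[of \<alpha>, OF \<alpha> norm_cis \<mu>] by blast
          show "\<not> has_radial_limit (f_plus \<alpha> j) (cis t) 0" if "\<alpha> j \<noteq> 0" for j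
            using elim(2) that by blast
          show "\<not> has_radial_limit (f_minus \<alpha> (j + 1)) (cis t) 0" if "\<alpha> j \<noteq> 0" for j
            using elim(3) that by blast
          show "\<not> has_radial_limit (\<lambda>z. z * f_minus \<alpha> j z - cnj (\<alpha> j)) (cis t) 0" if "cmod (\<alpha> j) = 1" for j
            using elim(4) that by blast
          show "\<not> has_radial_limit (\<lambda>z. z * f_plus \<alpha> (j + 1) z + \<alpha> j) (cis t) 0" if "cmod (\<alpha> j) = 1" for j
            using elim(5) that by blast
          show "cis t ^ Suc d * (\<alpha> j * cnj (\<alpha> i)) \<notin> \<real>" if "\<alpha> i \<noteq> 0" "\<alpha> j \<noteq> 0" for i j d
            using elim(6) that by blast
        qed
      qed
    qed
    then have "AE t in ?M. cis t \<in> A \<longrightarrow> reflectionless_at \<alpha> (cis t) i" for i by eventually_elim auto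
    then show "reflectionless_cmv \<alpha> A"
      by (simp add: reflectionless_cmv_def ae_on_circle_def reflectionless_at_def)
  }
qed

end
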